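(* Let $(G,+)$ be an abelian group. The following data are equivalent. (1) An abelian regular subgroup $N$ of $S(G)$ such that $N \trianglelefteq \mathrm{Hol}(G)$. (2) A group homomorphism $\gamma : G \to \mathrm{Aut}(G)$ such that $\gamma(g^{\beta}) = \gamma(g)^{\beta}$ for all $g \in G$ and $\beta \in \mathrm{Aut}(G)$. (3) A commutative ring structure $(G,+,\cdot)$ such that (a) the operation $g \circ h = g + h + g h$ defines a group structure $(G,\circ)$, (b) $g h k = 0$ for all $g,h,k \in G$, and (c) each automorphism of the group $(G,+)$ is also an automorphism of the ring $(G,+,\cdot)$. (Here the data in (1) and (2) correspond to each other via $N = \{\gamma(g)\rho(g) : g \in G\}$, and the data in (2) and (3) via $g \cdot h = -g + g^{\gamma(h)}$, equivalently $h^{\gamma(g)} = h + hg$.) Moreover, under these assumptions: (i) in terms of (2), the operations of (3) are given by $g \cdot h = -g + g^{\gamma(h)}$ and $g \circ h = g^{\gamma(h)} + h$ for $g,h \in G$; (ii) the function $\nu : G \to N$, $\nu(g) = \gamma(g)\rho(g)$, is an isomorphism $(G,\circ) \to N$; (iii) every automorphism of $(G,+)$ is also an automorphism of $(G,\circ)$.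
   Context: $S(G)$ is the group of all permutations of the set $G$. Permutations act on the right and are written as exponents: $x^{\sigma}$ is the image of $x$ under $\sigma$, and $x^{\sigma\tau} = (x^{\sigma})^{\tau}$. The map $\rho : G \to S(G)$, $x^{\rho(g)} = x + g$, is the (right) regular representation, and $\mathrm{Hol}(G) = N_{S(G)}(\rho(G)) = \mathrm{Aut}(G)\,\rho(G)$. For elements $\sigma,\beta$ of a group, $\sigma^{\beta} = \beta^{-1}\sigma\beta$. A subgroup $N \le S(G)$ is regular if it acts regularly (sharply transitively) on $G$; for such $N \le \mathrm{Hol}(G)$, $\nu(g)$ denotes the unique element of $N$ with $0^{\nu(g)} = g$, and it can be written uniquely as $\nu(g) = \gamma(g)\rho(g)$ with $\gamma(g) \in \mathrm{Aut}(G)$. Rings are associative and not required to have a unity.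
   Formalization: As printed, (2) does not force commutativity (G = Z, γ(n): x ↦ (-1)^n x gives a dihedral N), so the correspondences of (2) with (1) and (3) are stated only for those γ whose permutations γ(g)ρ(g) commute pairwise; (i)-(iii) are stated for all γ in (2). *)

theory Defs
  imports "HOL-Algebra.Algebra"
begin

text \<open>
  The abelian group \<open>(G, +)\<close> is a ring record \<open>G\<close> with \<^term>\<open>abelian_group G\<close>; this locale
  constrains only \<open>carrier\<close>, \<open>add\<close> and \<open>zero\<close>, and the \<open>mult\<close> and \<open>one\<close> fields of \<open>G\<close> are never used.
  Everything living on \<open>G\<close> is taken extensional, so that equality of permutations, of maps
  \<open>G \<rightarrow> Aut(G)\<close> and of multiplications is equality on the carrier.
\<close>

section \<open>Permutations acting on the right\<close>

text \<open>
  Permutations act on the right, so \<open>\<sigma>\<tau>\<close> means first \<open>\<sigma>\<close>, then \<open>\<tau>\<close>: the group \<open>S(G)\<close> is the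
  opposite of \<^const>\<open>BijGroup\<close>. The image of \<open>x\<close> under \<open>\<sigma>\<close> is written \<open>\<sigma> x\<close>.
\<close>

definition Sym :: "('a, 'b) ring_scheme \<Rightarrow> ('a \<Rightarrow> 'a) monoid" where
  "Sym G = BijGroup (carrier G) \<lparr>mult := \<lambda>\<sigma> \<tau>. \<tau> \<otimes>\<^bsub>BijGroup (carrier G)\<^esub> \<sigma>\<rparr>"

abbreviation add_auto :: "('a, 'b) ring_scheme \<Rightarrow> ('a \<Rightarrow> 'a) set" where
  "add_auto G \<equiv> auto (add_monoid G)"

definition Aut :: "('a, 'b) ring_scheme \<Rightarrow> ('a \<Rightarrow> 'a) monoid" where
  "Aut G = (Sym G) \<lparr>carrier := add_auto G\<rparr>"

definition rho :: "('a, 'b) ring_scheme \<Rightarrow> 'a \<Rightarrow> 'a \<Rightarrow> 'a" where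
  "rho G g = (\<lambda>x\<in>carrier G. x \<oplus>\<^bsub>G\<^esub> g)"

definition Hol :: "('a, 'b) ring_scheme \<Rightarrow> ('a \<Rightarrow> 'a) monoid" where
  "Hol G = (Sym G) \<lparr>carrier := normalizer (Sym G) (rho G ` carrier G)\<rparr>"

definition regular_on :: "'a set \<Rightarrow> ('a \<Rightarrow> 'a) set \<Rightarrow> bool" where
  "regular_on S N \<longleftrightarrow> (\<forall>x\<in>S. \<forall>y\<in>S. \<exists>!\<sigma>. \<sigma> \<in> N \<and> \<sigma> x = y)"

definition conj_by :: "('a, 'b) monoid_scheme \<Rightarrow> 'a \<Rightarrow> 'a \<Rightarrow> 'a" where
  "conj_by H \<sigma> \<beta> = inv\<^bsub>H\<^esub> \<beta> \<otimes>\<^bsub>H\<^esub> \<sigma> \<otimes>\<^bsub>H\<^esub> \<beta>"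

definition nu :: "('a, 'b) ring_scheme \<Rightarrow> ('a \<Rightarrow> 'a) set \<Rightarrow> 'a \<Rightarrow> 'a \<Rightarrow> 'a" where
  "nu G N g = (THE \<sigma>. \<sigma> \<in> N \<and> \<sigma> \<zero>\<^bsub>G\<^esub> = g)"


section \<open>Commutative rings without unity\<close>

text \<open>The locale \<^locale>\<open>cring\<close> requires a unity; here \<open>one\<close> is not constrained.\<close>

locale comm_rng = abelian_group R for R (structure) +
  assumes m_closed: "\<lbrakk>x \<in> carrier R; y \<in> carrier R\<rbrakk> \<Longrightarrow> x \<otimes> y \<in> carrier R"
    and m_assoc: "\<lbrakk>x \<in> carrier R; y \<in> carrier R; z \<in> carrier R\<rbrakk> \<Longrightarrow> (x \<otimes> y) \<otimes> z = x \<otimes> (y \<otimes> z)"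
    and m_comm: "\<lbrakk>x \<in> carrier R; y \<in> carrier R\<rbrakk> \<Longrightarrow> x \<otimes> y = y \<otimes> x"
    and l_distr: "\<lbrakk>x \<in> carrier R; y \<in> carrier R; z \<in> carrier R\<rbrakk>
        \<Longrightarrow> (x \<oplus> y) \<otimes> z = (x \<otimes> z) \<oplus> (y \<otimes> z)"

text \<open>\<^term>\<open>auto R\<close> reads \<open>R\<close> as its multiplicative structure, ignoring \<open>one\<close>.\<close>

definition rng_auto :: "('a, 'b) ring_scheme \<Rightarrow> ('a \<Rightarrow> 'a) set" where
  "rng_auto R = add_auto R \<inter> auto R"

text \<open>
  The circle operation.  In a ring \<open>0 \<circ> g = g = g \<circ> 0\<close>, so \<open>0\<close> is the only possible identity
  and fixing it in the record loses nothing.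
\<close>

definition circ :: "('a, 'b) ring_scheme \<Rightarrow> 'a monoid" where
  "circ R = \<lparr>carrier = carrier R,
             monoid.mult = \<lambda>g h. g \<oplus>\<^bsub>R\<^esub> h \<oplus>\<^bsub>R\<^esub> (g \<otimes>\<^bsub>R\<^esub> h),
             one = \<zero>\<^bsub>R\<^esub>\<rparr>"

abbreviation with_mult :: "('a, 'b) ring_scheme \<Rightarrow> ('a \<Rightarrow> 'a \<Rightarrow> 'a) \<Rightarrow> ('a, 'b) ring_scheme" where
  "with_mult G m \<equiv> G \<lparr>mult := m\<rparr>"


section \<open>The three kinds of data\<close>

definition regular_normal :: "('a, 'b) ring_scheme \<Rightarrow> ('a \<Rightarrow> 'a) set set" where
  "regular_normal G = {N. subgroup N (Sym G) \<and> regular_on (carrier G) N \<and> N \<lhd> Hol G}"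

definition data1 :: "('a, 'b) ring_scheme \<Rightarrow> ('a \<Rightarrow> 'a) set set" where
  "data1 G = {N \<in> regular_normal G. comm_group ((Sym G) \<lparr>carrier := N\<rparr>)}"

definition data2 :: "('a, 'b) ring_scheme \<Rightarrow> ('a \<Rightarrow> 'a \<Rightarrow> 'a) set" where
  "data2 G = {\<gamma> \<in> extensional (carrier G).
     \<gamma> \<in> hom (add_monoid G) (Aut G) \<and>
     (\<forall>g\<in>carrier G. \<forall>\<beta>\<in>add_auto G. \<gamma> (\<beta> g) = conj_by (Aut G) (\<gamma> g) \<beta>)}"

definition data3 :: "('a, 'b) ring_scheme \<Rightarrow> ('a \<Rightarrow> 'a \<Rightarrow> 'a) set" where
  "data3 G = {m \<in> extensional (carrier G). (\<forall>g\<in>carrier G. m g \<in> extensional (carrier G)) \<and>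
     comm_rng (with_mult G m) \<and>
     group (circ (with_mult G m)) \<and>
     (\<forall>g\<in>carrier G. \<forall>h\<in>carrier G. \<forall>k\<in>carrier G. m (m g h) k = \<zero>\<^bsub>G\<^esub>) \<and>
     add_auto G \<subseteq> rng_auto (with_mult G m)}"

text \<open>
  The permutations \<open>\<gamma>(g)\<rho>(g)\<close> and \<open>\<gamma>(h)\<rho>(h)\<close> commute for all \<open>g\<close>, \<open>h\<close>.  For \<open>\<gamma>\<close> in
  \<^term>\<open>data2 G\<close> this is the same as \<open>-g + g\<^sup>\<gamma>\<^sup>(\<^sup>h\<^sup>) = -h + h\<^sup>\<gamma>\<^sup>(\<^sup>g\<^sup>)\<close>, and it does not
  follow from membership in \<^term>\<open>data2 G\<close>: for \<open>G = \<int>\<close> and \<open>\<gamma>(n) : x \<mapsto> (-1)\<^sup>n x\<close> the set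
  \<open>{\<gamma>(g)\<rho>(g)}\<close> is an infinite dihedral group and \<open>1 \<cdot> 2 = 0 \<noteq> -4 = 2 \<cdot> 1\<close>.
\<close>

definition gamma_rho_commute :: "('a, 'b) ring_scheme \<Rightarrow> ('a \<Rightarrow> 'a \<Rightarrow> 'a) \<Rightarrow> bool" where
  "gamma_rho_commute G \<gamma> \<longleftrightarrow> (\<forall>g\<in>carrier G. \<forall>h\<in>carrier G.
     (\<gamma> g \<otimes>\<^bsub>Sym G\<^esub> rho G g) \<otimes>\<^bsub>Sym G\<^esub> (\<gamma> h \<otimes>\<^bsub>Sym G\<^esub> rho G h) =
     (\<gamma> h \<otimes>\<^bsub>Sym G\<^esub> rho G h) \<otimes>\<^bsub>Sym G\<^esub> (\<gamma> g \<otimes>\<^bsub>Sym G\<^esub> rho G g))"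


section \<open>The correspondences between the data\<close>

definition gamma_rho :: "('a, 'b) ring_scheme \<Rightarrow> ('a \<Rightarrow> 'a \<Rightarrow> 'a) \<Rightarrow> ('a \<Rightarrow> 'a) set" where
  "gamma_rho G \<gamma> = {\<gamma> g \<otimes>\<^bsub>Sym G\<^esub> rho G g | g. g \<in> carrier G}"

definition gamma_mult :: "('a, 'b) ring_scheme \<Rightarrow> ('a \<Rightarrow> 'a \<Rightarrow> 'a) \<Rightarrow> 'a \<Rightarrow> 'a \<Rightarrow> 'a" where
  "gamma_mult G \<gamma> = (\<lambda>g\<in>carrier G. \<lambda>h\<in>carrier G. \<ominus>\<^bsub>G\<^esub> g \<oplus>\<^bsub>G\<^esub> \<gamma> h g)"

end

theory Submission
  imports Defs
begin

text \<open>
  All three kinds of data describe one map \<open>\<gamma>\<close>.  A permutation \<open>\<nu>(g)\<close> in the holomorph with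
  \<open>0\<^sup>\<nu>\<^sup>(\<^sup>g\<^sup>) = g\<close> is affine, so it is \<open>x \<mapsto> x\<^sup>\<gamma>\<^sup>(\<^sup>g\<^sup>) + g\<close> for an automorphism \<open>\<gamma>(g)\<close>, and composing
  affine maps gives \<open>\<nu>(g)\<nu>(h) : x \<mapsto> x\<^sup>\<gamma>\<^sup>(\<^sup>g\<^sup>)\<^sup>\<gamma>\<^sup>(\<^sup>h\<^sup>) + (g\<^sup>\<gamma>\<^sup>(\<^sup>h\<^sup>) + h)\<close>.  So the \<open>\<nu>(g)\<close> form a group
  exactly when \<open>\<gamma>(g)\<gamma>(h) = \<gamma>(g\<^sup>\<gamma>\<^sup>(\<^sup>h\<^sup>) + h)\<close>, whereas a homomorphism satisfies
  \<open>\<gamma>(g)\<gamma>(h) = \<gamma>(g + h)\<close>.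

  The bridge is that \<open>\<gamma>(g\<^sup>\<gamma>\<^sup>(\<^sup>h\<^sup>)) = \<gamma>(g)\<^sup>\<gamma>\<^sup>(\<^sup>h\<^sup>) = \<gamma>(g)\<close>: the first equality is equivariance under the
  automorphism \<open>\<gamma>(h)\<close>, the second holds as soon as the image of \<open>\<gamma>\<close> is commutative.  For a
  homomorphism on an abelian group this is automatic; for a regular subgroup it comes from the
  subgroup being abelian.  Equivariance itself is normality of the subgroup, tested on automorphisms
  (\<open>data1_imp_data2\<close>).  Conversely, the bridge puts every \<open>-g + g\<^sup>\<gamma>\<^sup>(\<^sup>h\<^sup>)\<close> into the kernel of
  \<open>\<gamma>\<close> (\<open>\<gamma>_kernel\<close>), which is what makes the subgroup stable under the translations in the holomorph
  (\<open>normal_gamma_rho\<close>).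

  For the ring, put \<open>gh = -g + g\<^sup>\<gamma>\<^sup>(\<^sup>h\<^sup>)\<close>.  Commutativity of the \<open>\<nu>(g)\<close>, evaluated at \<open>0\<close>, is
  commutativity of this product.  Products lie in the kernel of \<open>\<gamma>\<close>, so \<open>k(gh) = 0\<close>
  (\<open>gamma_mult_data3\<close>).  In the other direction \<open>x \<mapsto> x + xg\<close> is an automorphism with inverse
  \<open>x \<mapsto> x - xg\<close> because triple products vanish, and for the same reason the quadratic term in
  \<open>x + xg + xh + xgh\<close> drops out, which leaves a homomorphism in \<open>g\<close> (\<open>mult_gamma_data2\<close>).
  The circle operation \<open>g + h + gh\<close> is \<open>g\<^sup>\<gamma>\<^sup>(\<^sup>h\<^sup>) + h\<close>, the composition law of the \<open>\<nu>(g)\<close>.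
\<close>

section \<open>Normalizers and normal subgroups without inverses\<close>

text \<open>
  Inverses of permutations have no pointwise formula.  Written as a commutation rule \<open>gh = h'g\<close>,
  membership in a normalizer becomes a statement about values of functions; the next lemmas do the
  same for normality and for conjugation.
\<close>

lemma (in group) mem_normalizer_iff:
  assumes H: "H \<subseteq> carrier G"
  shows "g \<in> normalizer G H \<longleftrightarrow> g \<in> carrier G \<and>
    (\<forall>h\<in>H. \<exists>h'\<in>H. g \<otimes> h = h' \<otimes> g) \<and> (\<forall>h'\<in>H. \<exists>h\<in>H. g \<otimes> h = h' \<otimes> g)"
proof (cases "g \<in> carrier G")
  case True
  have conj_eq: "g \<otimes> h \<otimes> inv g = h' \<longleftrightarrow> g \<otimes> h = h' \<otimes> g" if "h \<in> H" "h' \<in> H" for h h'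
    using that H True by (metis inv_solve_right m_closed subset_eq)
  have conj_closed: "\<exists>h'\<in>H. g \<otimes> h = h' \<otimes> g" if "h \<in> H" "g \<otimes> h \<otimes> inv g \<in> H" for h
    using that conj_eq by blast
  have "g \<in> normalizer G H \<longleftrightarrow> (\<lambda>h. g \<otimes> h \<otimes> inv g) ` H = H"
  proof -
    have "g <# H #> inv g = (\<lambda>h. g \<otimes> h \<otimes> inv g) ` H"
      by (auto simp: l_coset_def r_coset_def)
    then show ?thesis using True H by (simp add: normalizer_def stabilizer_def)
  qed
  also have "\<dots> \<longleftrightarrow> (\<forall>h\<in>H. \<exists>h'\<in>H. g \<otimes> h = h' \<otimes> g) \<and> (\<forall>h'\<in>H. \<exists>h\<in>H. g \<otimes> h = h' \<otimes> g)"
    (is "?L \<longleftrightarrow> ?R")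
  proof
    assume ?L
    then show ?R using conj_closed conj_eq by (metis (no_types, lifting) image_iff)
  next
    assume R: ?R
    show ?L
    proof
      show "(\<lambda>h. g \<otimes> h \<otimes> inv g) ` H \<subseteq> H" using R conj_eq by (metis (no_types, lifting) image_subsetI)
      show "H \<subseteq> (\<lambda>h. g \<otimes> h \<otimes> inv g) ` H" using R conj_eq by (metis (no_types, lifting) image_eqI subsetI)
    qed
  qed
  finally show ?thesis using True by simp
qed (simp add: normalizer_def stabilizer_def)

lemma (in group) normalI_commute:
  assumes N: "subgroup N G"
    and comm: "\<And>x n. \<lbrakk>x \<in> carrier G; n \<in> N\<rbrakk> \<Longrightarrow> \<exists>n'\<in>N. x \<otimes> n = n' \<otimes> x"
  shows "N \<lhd> G"
proof (rule normal_invI[OF N])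
  fix x n assume x: "x \<in> carrier G" and n: "n \<in> N"
  obtain n' where "n' \<in> N" "x \<otimes> n = n' \<otimes> x" using comm[OF x n] by blast
  then show "x \<otimes> n \<otimes> inv x \<in> N"
    using x n subgroup.mem_carrier[OF N] by (metis inv_solve_right m_closed)
qed

lemma normal_commute:
  assumes "N \<lhd> H" "x \<in> carrier H" "n \<in> N"
  shows "\<exists>n'\<in>N. n \<otimes>\<^bsub>H\<^esub> x = x \<otimes>\<^bsub>H\<^esub> n'"
  using normal.coset_eq[OF assms(1)] assms(2,3) by (fastforce simp: r_coset_def l_coset_def)

lemma (in group) conj_by_eq_iff:
  assumes "\<sigma> \<in> carrier G" "\<beta> \<in> carrier G" "\<tau> \<in> carrier G"
  shows "\<tau> = conj_by G \<sigma> \<beta> \<longleftrightarrow> \<sigma> \<otimes> \<beta> = \<beta> \<otimes> \<tau>"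
  using assms by (metis conj_by_def inv_closed inv_solve_left m_assoc m_closed)


section \<open>Permutations and automorphisms acting pointwise\<close>

lemma carrier_Sym [simp]: "carrier (Sym G) = Bij (carrier G)"
  by (simp add: Sym_def BijGroup_def)

lemma Sym_mult: "\<lbrakk>\<sigma> \<in> Bij (carrier G); \<tau> \<in> Bij (carrier G)\<rbrakk> \<Longrightarrow> \<sigma> \<otimes>\<^bsub>Sym G\<^esub> \<tau> = compose (carrier G) \<tau> \<sigma>"
  by (simp add: Sym_def BijGroup_def)

lemma Sym_mult_Bij:
  "\<lbrakk>\<sigma> \<in> Bij (carrier G); \<tau> \<in> Bij (carrier G)\<rbrakk> \<Longrightarrow> \<sigma> \<otimes>\<^bsub>Sym G\<^esub> \<tau> \<in> Bij (carrier G)"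
  by (simp add: Sym_mult compose_Bij)

lemma Sym_mult_apply:
  "\<lbrakk>\<sigma> \<in> Bij (carrier G); \<tau> \<in> Bij (carrier G); x \<in> carrier G\<rbrakk> \<Longrightarrow> (\<sigma> \<otimes>\<^bsub>Sym G\<^esub> \<tau>) x = \<tau> (\<sigma> x)"
  by (simp add: Sym_mult compose_def)

lemma Sym_one: "\<one>\<^bsub>Sym G\<^esub> = (\<lambda>x\<in>carrier G. x)"
  by (simp add: Sym_def BijGroup_def)

lemma Bij_closed: "\<lbrakk>\<sigma> \<in> Bij S; x \<in> S\<rbrakk> \<Longrightarrow> \<sigma> x \<in> S"
  using Bij_imp_funcset by fastforce

lemma Bij_eq_iff: "\<lbrakk>\<sigma> \<in> Bij S; x \<in> S; y \<in> S\<rbrakk> \<Longrightarrow> \<sigma> x = \<sigma> y \<longleftrightarrow> x = y"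
  by (auto simp: Bij_def bij_betw_def inj_on_def)

lemma Bij_onto: "\<lbrakk>\<sigma> \<in> Bij S; y \<in> S\<rbrakk> \<Longrightarrow> \<exists>x\<in>S. \<sigma> x = y"
  unfolding Bij_def bij_betw_def by (metis (mono_tags, lifting) IntD2 imageE mem_Collect_eq)

lemma Bij_ext: "\<lbrakk>\<sigma> \<in> Bij S; \<tau> \<in> Bij S; \<And>x. x \<in> S \<Longrightarrow> \<sigma> x = \<tau> x\<rbrakk> \<Longrightarrow> \<sigma> = \<tau>"
  by (meson Bij_imp_extensional extensionalityI)

lemma BijI:
  assumes "f \<in> extensional S" "\<And>x. x \<in> S \<Longrightarrow> f x \<in> S"
    "\<And>x y. \<lbrakk>x \<in> S; y \<in> S; f x = f y\<rbrakk> \<Longrightarrow> x = y" "\<And>y. y \<in> S \<Longrightarrow> \<exists>x\<in>S. f x = y"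
  shows "f \<in> Bij S"
  using assms unfolding Bij_def bij_betw_def inj_on_def by blast

lemma Sym_mult_eq_iff:
  assumes "\<sigma> \<in> Bij (carrier G)" "\<tau> \<in> Bij (carrier G)" "\<sigma>' \<in> Bij (carrier G)" "\<tau>' \<in> Bij (carrier G)"
  shows "\<sigma> \<otimes>\<^bsub>Sym G\<^esub> \<tau> = \<sigma>' \<otimes>\<^bsub>Sym G\<^esub> \<tau>' \<longleftrightarrow> (\<forall>x\<in>carrier G. \<tau> (\<sigma> x) = \<tau>' (\<sigma>' x))"
proof
  assume "\<sigma> \<otimes>\<^bsub>Sym G\<^esub> \<tau> = \<sigma>' \<otimes>\<^bsub>Sym G\<^esub> \<tau>'"
  then show "\<forall>x\<in>carrier G. \<tau> (\<sigma> x) = \<tau>' (\<sigma>' x)"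
    using assms Sym_mult_apply[of _ G] by metis
next
  assume "\<forall>x\<in>carrier G. \<tau> (\<sigma> x) = \<tau>' (\<sigma>' x)"
  with assms show "\<sigma> \<otimes>\<^bsub>Sym G\<^esub> \<tau> = \<sigma>' \<otimes>\<^bsub>Sym G\<^esub> \<tau>'"
    by (simp add: Sym_mult compose_def restrict_def fun_eq_iff)
qed

lemma group_Sym: "group (Sym G)"
proof (rule groupI)
  fix \<sigma> assume "\<sigma> \<in> carrier (Sym G)"
  then have \<sigma>: "\<sigma> \<in> Bij (carrier G)" by simp
  let ?\<tau> = "restrict (inv_into (carrier G) \<sigma>) (carrier G)"
  have \<tau>: "?\<tau> \<in> Bij (carrier G)" using \<sigma> by (rule restrict_inv_into_Bij)
  have "?\<tau> \<otimes>\<^bsub>Sym G\<^esub> \<sigma> = \<one>\<^bsub>Sym G\<^esub>"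
  proof (rule Bij_ext)
    fix x assume "x \<in> carrier G"
    then show "(?\<tau> \<otimes>\<^bsub>Sym G\<^esub> \<sigma>) x = \<one>\<^bsub>Sym G\<^esub> x"
      using \<sigma> \<tau> by (simp add: Sym_mult_apply Sym_one) (simp add: Bij_def bij_betw_def f_inv_into_f)
  qed (use \<sigma> \<tau> in \<open>auto simp: Sym_mult_Bij Sym_one id_Bij\<close>)
  then show "\<exists>\<tau>\<in>carrier (Sym G). \<tau> \<otimes>\<^bsub>Sym G\<^esub> \<sigma> = \<one>\<^bsub>Sym G\<^esub>" using \<tau> by auto
next
  fix \<sigma> \<tau> \<upsilon> assume "\<sigma> \<in> carrier (Sym G)" "\<tau> \<in> carrier (Sym G)" "\<upsilon> \<in> carrier (Sym G)"
  then show "\<sigma> \<otimes>\<^bsub>Sym G\<^esub> \<tau> \<otimes>\<^bsub>Sym G\<^esub> \<upsilon> = \<sigma> \<otimes>\<^bsub>Sym G\<^esub> (\<tau> \<otimes>\<^bsub>Sym G\<^esub> \<upsilon>)"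
    by (simp add: Sym_mult_eq_iff Sym_mult_Bij Sym_mult_apply Bij_closed)
next
  fix \<sigma> assume "\<sigma> \<in> carrier (Sym G)"
  then show "\<one>\<^bsub>Sym G\<^esub> \<otimes>\<^bsub>Sym G\<^esub> \<sigma> = \<sigma>"
    by (intro Bij_ext[of _ "carrier G"]) (simp_all add: Sym_mult_Bij Sym_mult_apply Sym_one id_Bij)
qed (simp_all add: Sym_mult_Bij Sym_one id_Bij)

lemma inv_Sym:
  assumes "\<sigma> \<in> Bij (carrier G)"
  shows "inv\<^bsub>Sym G\<^esub> \<sigma> \<in> Bij (carrier G)"
    and "\<And>x. x \<in> carrier G \<Longrightarrow> \<sigma> ((inv\<^bsub>Sym G\<^esub> \<sigma>) x) = x"
proof -
  interpret S: group "Sym G" by (rule group_Sym)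
  show 1: "inv\<^bsub>Sym G\<^esub> \<sigma> \<in> Bij (carrier G)" using S.inv_closed assms by simp
  show "\<sigma> ((inv\<^bsub>Sym G\<^esub> \<sigma>) x) = x" if "x \<in> carrier G" for x
    using S.l_inv[of \<sigma>] assms 1 that by (metis Sym_mult_apply Sym_one carrier_Sym restrict_apply')
qed

lemma add_auto_Bij: "\<beta> \<in> add_auto G \<Longrightarrow> \<beta> \<in> Bij (carrier G)"
  by (simp add: auto_def)

lemma add_auto_closed: "\<lbrakk>\<beta> \<in> add_auto G; x \<in> carrier G\<rbrakk> \<Longrightarrow> \<beta> x \<in> carrier G"
  by (simp add: add_auto_Bij Bij_closed)

lemma add_auto_add:
  "\<lbrakk>\<beta> \<in> add_auto G; x \<in> carrier G; y \<in> carrier G\<rbrakk> \<Longrightarrow> \<beta> (x \<oplus>\<^bsub>G\<^esub> y) = \<beta> x \<oplus>\<^bsub>G\<^esub> \<beta> y"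
  by (simp add: auto_def hom_def)

lemma add_autoI:
  assumes "\<beta> \<in> Bij (carrier G)"
    "\<And>x y. \<lbrakk>x \<in> carrier G; y \<in> carrier G\<rbrakk> \<Longrightarrow> \<beta> (x \<oplus>\<^bsub>G\<^esub> y) = \<beta> x \<oplus>\<^bsub>G\<^esub> \<beta> y"
  shows "\<beta> \<in> add_auto G"
  using assms by (auto simp: auto_def hom_def Bij_closed)

context abelian_group
begin

lemma add_auto_zero: assumes "\<beta> \<in> add_auto G" shows "\<beta> \<zero> = \<zero>"
proof -
  have "\<beta> \<zero> = \<beta> \<zero> \<oplus> \<beta> \<zero>" using add_auto_add[OF assms, of \<zero> \<zero>] by simp
  then show ?thesis using add_auto_closed[OF assms, of \<zero>] by (metis add.r_cancel_one' zero_closed)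
qed

lemma add_auto_minus:
  assumes "\<beta> \<in> add_auto G" "x \<in> carrier G" shows "\<beta> (\<ominus> x) = \<ominus> \<beta> x"
proof -
  have "\<beta> (\<ominus> x) \<oplus> \<beta> x = \<zero>"
    using add_auto_add[OF assms(1), of "\<ominus> x" x] assms by (simp add: l_neg add_auto_zero)
  then show ?thesis using assms by (metis a_inv_closed add_auto_closed minus_equality)
qed

lemma subgroup_add_auto: "subgroup (add_auto G) (Sym G)"
proof (rule group.subgroupI[OF group_Sym])
  show "add_auto G \<subseteq> carrier (Sym G)" by (auto simp: add_auto_Bij)
  have "\<one>\<^bsub>Sym G\<^esub> \<in> add_auto G" by (rule add_autoI) (auto simp: Sym_one id_Bij)
  then show "add_auto G \<noteq> {}" by blast
  fix \<beta> assume \<beta>: "\<beta> \<in> add_auto G"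
  note B = add_auto_Bij[OF \<beta>]
  show "inv\<^bsub>Sym G\<^esub> \<beta> \<in> add_auto G"
  proof (rule add_autoI)
    fix x y assume xy: "x \<in> carrier G" "y \<in> carrier G"
    let ?i = "inv\<^bsub>Sym G\<^esub> \<beta>"
    have c: "?i z \<in> carrier G" if "z \<in> carrier G" for z using inv_Sym(1)[OF B] that by (rule Bij_closed)
    have "\<beta> (?i (x \<oplus> y)) = \<beta> (?i x \<oplus> ?i y)"
      using xy c by (simp add: add_auto_add[OF \<beta>] inv_Sym(2)[OF B])
    then show "?i (x \<oplus> y) = ?i x \<oplus> ?i y" using xy c Bij_eq_iff[OF B] by simp
  qed (rule inv_Sym(1)[OF B])
  fix \<beta>' assume \<beta>': "\<beta>' \<in> add_auto G"
  show "\<beta> \<otimes>\<^bsub>Sym G\<^esub> \<beta>' \<in> add_auto G"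
    using \<beta> \<beta>' by (intro add_autoI) (auto simp: Sym_mult_Bij Sym_mult_apply add_auto_Bij add_auto_closed add_auto_add)
qed

lemma group_Aut: "group (Aut G)"
  unfolding Aut_def by (rule group.subgroup_imp_group[OF group_Sym subgroup_add_auto])

lemma carrier_Aut: "carrier (Aut G) = add_auto G" and mult_Aut: "monoid.mult (Aut G) = monoid.mult (Sym G)"
  by (simp_all add: Aut_def)

lemma rho_Bij:
  assumes g: "g \<in> carrier G"
  shows "rho G g \<in> Bij (carrier G)"
proof (rule BijI)
  show "rho G g \<in> extensional (carrier G)" unfolding rho_def by (rule restrict_extensional)
  show "rho G g x \<in> carrier G" if "x \<in> carrier G" for x
    using that g by (simp add: rho_def)
  show "x = y" if "x \<in> carrier G" "y \<in> carrier G" "rho G g x = rho G g y" for x y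
    using that g by (simp add: rho_def)
  show "\<exists>x\<in>carrier G. rho G g x = y" if y: "y \<in> carrier G" for y
  proof
    show "y \<oplus> \<ominus> g \<in> carrier G" using g y by simp
    then show "rho G g (y \<oplus> \<ominus> g) = y"
      using g y by (simp add: rho_def a_assoc l_neg)
  qed
qed

lemma mult_rho_apply:
  "\<lbrakk>\<sigma> \<in> Bij (carrier G); g \<in> carrier G; x \<in> carrier G\<rbrakk> \<Longrightarrow> (\<sigma> \<otimes>\<^bsub>Sym G\<^esub> rho G g) x = \<sigma> x \<oplus> g"
  by (simp add: Sym_mult_apply rho_Bij Bij_closed) (simp add: rho_def Bij_closed)

lemma mult_rho_Bij:
  "\<lbrakk>\<sigma> \<in> Bij (carrier G); g \<in> carrier G\<rbrakk> \<Longrightarrow> \<sigma> \<otimes>\<^bsub>Sym G\<^esub> rho G g \<in> Bij (carrier G)"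
  by (simp add: Sym_mult_Bij rho_Bij)


section \<open>The holomorph consists of the affine permutations\<close>

text \<open>
  With permutations acting on the right, the commutation rule \<open>\<sigma> \<rho>(k) = \<rho>(h) \<sigma>\<close> reads
  \<open>\<sigma> x + k = \<sigma> (x + h)\<close>.
\<close>

lemma mem_Hol_commute:
  "\<sigma> \<in> carrier (Hol G) \<longleftrightarrow> \<sigma> \<in> Bij (carrier G) \<and>
    (\<forall>h\<in>carrier G. \<exists>k\<in>carrier G. \<forall>x\<in>carrier G. \<sigma> x \<oplus> k = \<sigma> (x \<oplus> h)) \<and>
    (\<forall>k\<in>carrier G. \<exists>h\<in>carrier G. \<forall>x\<in>carrier G. \<sigma> x \<oplus> k = \<sigma> (x \<oplus> h))"
proof (cases "\<sigma> \<in> Bij (carrier G)")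
  case True
  have "\<sigma> \<otimes>\<^bsub>Sym G\<^esub> rho G k = rho G h \<otimes>\<^bsub>Sym G\<^esub> \<sigma> \<longleftrightarrow> (\<forall>x\<in>carrier G. \<sigma> x \<oplus> k = \<sigma> (x \<oplus> h))"
    if "h \<in> carrier G" "k \<in> carrier G" for h k
    using that True by (simp add: Sym_mult_eq_iff rho_Bij) (auto simp: rho_def Bij_closed)
  moreover have "rho G ` carrier G \<subseteq> carrier (Sym G)" by (auto simp: rho_Bij)
  ultimately show ?thesis
    using True by (auto simp: Hol_def group.mem_normalizer_iff[OF group_Sym])
next
  case False
  moreover have "rho G ` carrier G \<subseteq> carrier (Sym G)" by (auto simp: rho_Bij)
  ultimately show ?thesis by (simp add: Hol_def group.mem_normalizer_iff[OF group_Sym])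
qed

text \<open>
  This is \<open>Hol(G) = Aut(G) \<rho>(G)\<close>.  If \<open>\<sigma> (x + h) = \<sigma> x + k\<close> for all \<open>x\<close>, then \<open>x = 0\<close> forces
  \<open>k = \<sigma> h - \<sigma> 0\<close>, so subtracting the constant \<open>\<sigma> 0\<close> from \<open>\<sigma>\<close> leaves an additive map.
\<close>

lemma mem_Hol_iff:
  "\<sigma> \<in> carrier (Hol G) \<longleftrightarrow> \<sigma> \<in> Bij (carrier G) \<and>
    (\<exists>\<beta>\<in>add_auto G. \<exists>k\<in>carrier G. \<forall>x\<in>carrier G. \<sigma> x = \<beta> x \<oplus> k)"
proof (intro iffI conjI)
  assume H: "\<sigma> \<in> carrier (Hol G)"
  then show B: "\<sigma> \<in> Bij (carrier G)" by (simp add: mem_Hol_commute)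
  note c = Bij_closed[OF B]
  let ?\<beta> = "\<sigma> \<otimes>\<^bsub>Sym G\<^esub> rho G (\<ominus> \<sigma> \<zero>)"
  have ap: "?\<beta> x = \<sigma> x \<oplus> \<ominus> \<sigma> \<zero>" if "x \<in> carrier G" for x
    using that B c by (simp add: mult_rho_apply)
  have add: "\<sigma> (x \<oplus> y) = \<sigma> x \<oplus> (\<sigma> y \<oplus> \<ominus> \<sigma> \<zero>)" if xy: "x \<in> carrier G" "y \<in> carrier G" for x y
  proof -
    obtain k where k: "k \<in> carrier G" "\<And>x. x \<in> carrier G \<Longrightarrow> \<sigma> x \<oplus> k = \<sigma> (x \<oplus> y)"
      using H xy by (auto simp: mem_Hol_commute)
    have "\<ominus> \<sigma> \<zero> \<oplus> (\<sigma> \<zero> \<oplus> k) = k" using k(1) c[of \<zero>] by (simp add: r_neg1)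
    then have "k = \<sigma> y \<oplus> \<ominus> \<sigma> \<zero>"
      using k(2)[of \<zero>] xy c by (simp add: a_comm)
    then show ?thesis using k(2)[of x] xy by simp
  qed
  have "?\<beta> \<in> add_auto G"
  proof (rule add_autoI)
    show "?\<beta> \<in> Bij (carrier G)" using B c by (simp add: mult_rho_Bij)
    fix x y assume xy: "x \<in> carrier G" "y \<in> carrier G"
    then show "?\<beta> (x \<oplus> y) = ?\<beta> x \<oplus> ?\<beta> y" using c by (simp add: ap add a_ac)
  qed
  moreover have "\<forall>x\<in>carrier G. \<sigma> x = ?\<beta> x \<oplus> \<sigma> \<zero>"
    using c by (simp add: ap a_assoc l_neg)
  ultimately show "\<exists>\<beta>\<in>add_auto G. \<exists>k\<in>carrier G. \<forall>x\<in>carrier G. \<sigma> x = \<beta> x \<oplus> k" using c by blast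
next
  assume R: "\<sigma> \<in> Bij (carrier G) \<and> (\<exists>\<beta>\<in>add_auto G. \<exists>k\<in>carrier G. \<forall>x\<in>carrier G. \<sigma> x = \<beta> x \<oplus> k)"
  then obtain \<beta> k where \<beta>: "\<beta> \<in> add_auto G" and k: "k \<in> carrier G"
    and \<sigma>: "\<And>x. x \<in> carrier G \<Longrightarrow> \<sigma> x = \<beta> x \<oplus> k" by blast
  have shift: "\<sigma> x \<oplus> \<beta> h = \<sigma> (x \<oplus> h)" if "x \<in> carrier G" "h \<in> carrier G" for x h
    using that \<beta> k by (simp add: \<sigma> add_auto_add add_auto_closed a_ac)
  then show "\<sigma> \<in> carrier (Hol G)"
    unfolding mem_Hol_commute
  proof (intro conjI ballI)
    fix k' assume "k' \<in> carrier G"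
    then obtain h where "h \<in> carrier G" "\<beta> h = k'" using Bij_onto[OF add_auto_Bij[OF \<beta>]] by blast
    with shift show "\<exists>h\<in>carrier G. \<forall>x\<in>carrier G. \<sigma> x \<oplus> k' = \<sigma> (x \<oplus> h)" by blast
  qed (use R shift add_auto_closed[OF \<beta>] in blast)+
qed

lemma add_auto_mem_Hol: "\<beta> \<in> add_auto G \<Longrightarrow> \<beta> \<in> carrier (Hol G)"
  unfolding mem_Hol_iff using add_auto_Bij add_auto_closed by (metis r_zero zero_closed)

lemma subgroup_Hol: "subgroup (carrier (Hol G)) (Sym G)"
  using group.normalizer_imp_subgroup[OF group_Sym[of G], of "rho G ` carrier G"]
  by (simp add: Hol_def image_subset_iff rho_Bij)

lemma Hol_eq: "Hol G = (Sym G)\<lparr>carrier := carrier (Hol G)\<rparr>"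
  by (simp add: Hol_def)

lemma group_Hol: "group (Hol G)"
  using group.subgroup_imp_group[OF group_Sym subgroup_Hol] Hol_eq by simp

lemma mult_Hol: "monoid.mult (Hol G) = monoid.mult (Sym G)"
  by (simp add: Hol_def)


section \<open>Homomorphisms into the automorphism group\<close>

text \<open>
  The condition \<open>\<gamma>(g\<^sup>\<beta>) = \<gamma>(g)\<^sup>\<beta>\<close> is multiplied through by \<open>\<beta>\<close>, so that it says how \<open>\<beta>\<close> moves past
  \<open>\<gamma>(g)\<close> when applied to a point.
\<close>

lemma data2_iff:
  "\<gamma> \<in> data2 G \<longleftrightarrow> \<gamma> \<in> extensional (carrier G) \<and> (\<forall>g\<in>carrier G. \<gamma> g \<in> add_auto G) \<and>
    (\<forall>g\<in>carrier G. \<forall>h\<in>carrier G. \<forall>x\<in>carrier G. \<gamma> (g \<oplus> h) x = \<gamma> h (\<gamma> g x)) \<and>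
    (\<forall>g\<in>carrier G. \<forall>\<beta>\<in>add_auto G. \<forall>x\<in>carrier G. \<beta> (\<gamma> g x) = \<gamma> (\<beta> g) (\<beta> x))"
proof (cases "\<forall>g\<in>carrier G. \<gamma> g \<in> add_auto G")
  case True
  then have A: "\<And>g. g \<in> carrier G \<Longrightarrow> \<gamma> g \<in> add_auto G"
    and B: "\<And>g. g \<in> carrier G \<Longrightarrow> \<gamma> g \<in> Bij (carrier G)" by (auto simp: add_auto_Bij)
  have mult: "\<gamma> (g \<oplus> h) = \<gamma> g \<otimes>\<^bsub>Sym G\<^esub> \<gamma> h \<longleftrightarrow> (\<forall>x\<in>carrier G. \<gamma> (g \<oplus> h) x = \<gamma> h (\<gamma> g x))"
    if "g \<in> carrier G" "h \<in> carrier G" for g h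
  proof
    assume "\<gamma> (g \<oplus> h) = \<gamma> g \<otimes>\<^bsub>Sym G\<^esub> \<gamma> h"
    then show "\<forall>x\<in>carrier G. \<gamma> (g \<oplus> h) x = \<gamma> h (\<gamma> g x)" using that by (simp add: Sym_mult_apply B)
  next
    assume "\<forall>x\<in>carrier G. \<gamma> (g \<oplus> h) x = \<gamma> h (\<gamma> g x)"
    then show "\<gamma> (g \<oplus> h) = \<gamma> g \<otimes>\<^bsub>Sym G\<^esub> \<gamma> h"
      using that by (intro Bij_ext[of _ "carrier G"]) (simp_all add: Sym_mult_Bij Sym_mult_apply B)
  qed
  have "\<gamma> \<in> hom (add_monoid G) (Aut G) \<longleftrightarrow>
    (\<forall>g\<in>carrier G. \<forall>h\<in>carrier G. \<gamma> (g \<oplus> h) = \<gamma> g \<otimes>\<^bsub>Sym G\<^esub> \<gamma> h)"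
    by (simp add: hom_def Pi_iff carrier_Aut mult_Aut A)
  also have "\<dots> \<longleftrightarrow> (\<forall>g\<in>carrier G. \<forall>h\<in>carrier G. \<forall>x\<in>carrier G. \<gamma> (g \<oplus> h) x = \<gamma> h (\<gamma> g x))"
    by (intro ball_cong refl) (rule mult)
  finally have hom: "\<gamma> \<in> hom (add_monoid G) (Aut G) \<longleftrightarrow>
    (\<forall>g\<in>carrier G. \<forall>h\<in>carrier G. \<forall>x\<in>carrier G. \<gamma> (g \<oplus> h) x = \<gamma> h (\<gamma> g x))" .
  have conj: "\<gamma> (\<beta> g) = conj_by (Aut G) (\<gamma> g) \<beta> \<longleftrightarrow> (\<forall>x\<in>carrier G. \<beta> (\<gamma> g x) = \<gamma> (\<beta> g) (\<beta> x))"
    if "g \<in> carrier G" "\<beta> \<in> add_auto G" for g \<beta>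
    using that by (simp add: group.conj_by_eq_iff[OF group_Aut] carrier_Aut mult_Aut A add_auto_closed
        Sym_mult_eq_iff add_auto_Bij)
  have equivariant: "(\<forall>g\<in>carrier G. \<forall>\<beta>\<in>add_auto G. \<gamma> (\<beta> g) = conj_by (Aut G) (\<gamma> g) \<beta>) \<longleftrightarrow>
    (\<forall>g\<in>carrier G. \<forall>\<beta>\<in>add_auto G. \<forall>x\<in>carrier G. \<beta> (\<gamma> g x) = \<gamma> (\<beta> g) (\<beta> x))"
    by (intro ball_cong refl) (rule conj)
  show ?thesis unfolding data2_def mem_Collect_eq hom equivariant using True by blast
next
  case False
  then have "\<gamma> \<notin> hom (add_monoid G) (Aut G)" by (auto simp: hom_def carrier_Aut)
  with False show ?thesis unfolding data2_def by blast
qed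

end

locale equivariant_hom = abelian_group G for G :: "('a, 'b) ring_scheme" (structure) +
  fixes \<gamma> :: "'a \<Rightarrow> 'a \<Rightarrow> 'a"
  assumes \<gamma>_data2: "\<gamma> \<in> data2 G"
begin

lemma \<gamma>_auto: "g \<in> carrier G \<Longrightarrow> \<gamma> g \<in> add_auto G"
  and \<gamma>_add: "\<lbrakk>g \<in> carrier G; h \<in> carrier G; x \<in> carrier G\<rbrakk> \<Longrightarrow> \<gamma> (g \<oplus> h) x = \<gamma> h (\<gamma> g x)"
  and \<gamma>_equivariant: "\<lbrakk>g \<in> carrier G; \<beta> \<in> add_auto G; x \<in> carrier G\<rbrakk> \<Longrightarrow> \<beta> (\<gamma> g x) = \<gamma> (\<beta> g) (\<beta> x)"
  using \<gamma>_data2 by (auto simp: data2_iff)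

lemma \<gamma>_Bij: "g \<in> carrier G \<Longrightarrow> \<gamma> g \<in> Bij (carrier G)"
  by (simp add: \<gamma>_auto add_auto_Bij)

lemma \<gamma>_closed [simp]: "\<lbrakk>g \<in> carrier G; x \<in> carrier G\<rbrakk> \<Longrightarrow> \<gamma> g x \<in> carrier G"
  by (simp add: \<gamma>_auto add_auto_closed)

lemma \<gamma>_zero: assumes "x \<in> carrier G" shows "\<gamma> \<zero> x = x"
proof -
  have "\<gamma> \<zero> (\<gamma> \<zero> x) = \<gamma> \<zero> x" using \<gamma>_add[of \<zero> \<zero> x] assms by simp
  then show ?thesis using Bij_eq_iff[OF \<gamma>_Bij] assms by simp
qed

lemma \<gamma>_commute:
  "\<lbrakk>g \<in> carrier G; h \<in> carrier G; x \<in> carrier G\<rbrakk> \<Longrightarrow> \<gamma> g (\<gamma> h x) = \<gamma> h (\<gamma> g x)"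
  using \<gamma>_add[of g h x] \<gamma>_add[of h g x] by (simp add: a_comm)

text \<open>
  By equivariance under the automorphism \<open>\<gamma>(h)\<close>, the left-hand automorphism is the conjugate of
  \<open>\<gamma>(g)\<close> by \<open>\<gamma>(h)\<close>, and the two commute.
\<close>

lemma \<gamma>_invariant:
  assumes "g \<in> carrier G" "h \<in> carrier G" "x \<in> carrier G" shows "\<gamma> (\<gamma> h g) x = \<gamma> g x"
proof -
  obtain y where y: "y \<in> carrier G" "\<gamma> h y = x" using Bij_onto[OF \<gamma>_Bij] assms by blast
  have "\<gamma> (\<gamma> h g) (\<gamma> h y) = \<gamma> h (\<gamma> g y)" using \<gamma>_equivariant[of g "\<gamma> h" y] \<gamma>_auto assms y by simp
  then show ?thesis using \<gamma>_commute assms y by simp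
qed

lemma \<gamma>_mult:
  "\<lbrakk>g \<in> carrier G; h \<in> carrier G; x \<in> carrier G\<rbrakk> \<Longrightarrow> \<gamma> (\<gamma> h g \<oplus> h) x = \<gamma> h (\<gamma> g x)"
  by (simp add: \<gamma>_add \<gamma>_invariant)

text \<open>
  The differences \<open>-g + g\<^sup>\<gamma>\<^sup>(\<^sup>h\<^sup>)\<close>, which become the products of the ring, act trivially, since
  \<open>\<gamma>\<close> takes the same value at \<open>g\<close> and at \<open>g\<^sup>\<gamma>\<^sup>(\<^sup>h\<^sup>)\<close>.
\<close>

lemma \<gamma>_kernel:
  assumes g: "g \<in> carrier G" and h: "h \<in> carrier G" and x: "x \<in> carrier G"
  shows "\<gamma> (\<ominus> g \<oplus> \<gamma> h g) x = x"
proof -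
  have "\<gamma> (\<ominus> g \<oplus> \<gamma> h g) x = \<gamma> (\<gamma> h g) (\<gamma> (\<ominus> g) x)" using g h x by (intro \<gamma>_add) simp_all
  also have "\<dots> = \<gamma> g (\<gamma> (\<ominus> g) x)" using g h x by (intro \<gamma>_invariant) simp_all
  also have "\<dots> = \<gamma> (\<ominus> g \<oplus> g) x" using g x by (intro \<gamma>_add[symmetric]) simp_all
  also have "\<dots> = x" using g x by (simp add: l_neg \<gamma>_zero)
  finally show ?thesis .
qed

abbreviation perm :: "'a \<Rightarrow> 'a \<Rightarrow> 'a" where
  "perm g \<equiv> \<gamma> g \<otimes>\<^bsub>Sym G\<^esub> rho G g"

lemma perm_Bij: "g \<in> carrier G \<Longrightarrow> perm g \<in> Bij (carrier G)"
  by (simp add: mult_rho_Bij \<gamma>_Bij)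

lemma perm_apply: "\<lbrakk>g \<in> carrier G; x \<in> carrier G\<rbrakk> \<Longrightarrow> perm g x = \<gamma> g x \<oplus> g"
  by (simp add: mult_rho_apply \<gamma>_Bij)

lemma perm_zero: "g \<in> carrier G \<Longrightarrow> perm g \<zero> = g"
  by (simp add: perm_apply add_auto_zero[OF \<gamma>_auto])

lemma perm_mult:
  assumes "g \<in> carrier G" "h \<in> carrier G"
  shows "perm g \<otimes>\<^bsub>Sym G\<^esub> perm h = perm (\<gamma> h g \<oplus> h)"
proof (rule Bij_ext)
  fix x assume x: "x \<in> carrier G"
  then show "(perm g \<otimes>\<^bsub>Sym G\<^esub> perm h) x = perm (\<gamma> h g \<oplus> h) x"
    using assms by (simp add: Sym_mult_apply perm_Bij perm_apply \<gamma>_mult add_auto_add[OF \<gamma>_auto] a_assoc)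
qed (use assms in \<open>simp_all add: Sym_mult_Bij perm_Bij\<close>)

lemma perm_eq_iff:
  assumes g: "g \<in> carrier G" and h: "h \<in> carrier G"
  shows "perm g = perm h \<longleftrightarrow> g = h"
proof
  assume "perm g = perm h"
  then have "perm g \<zero> = perm h \<zero>" by (rule fun_cong)
  then show "g = h" by (simp only: perm_zero[OF g] perm_zero[OF h])
qed simp

text \<open>
  A product of two of the permutations is again one of them, and these are determined by their
  value at \<open>0\<close>; so commuting is only a question of the value at \<open>0\<close>.
\<close>

lemma gamma_rho_commute_iff:
  "gamma_rho_commute G \<gamma> \<longleftrightarrow> (\<forall>g\<in>carrier G. \<forall>h\<in>carrier G. \<gamma> h g \<oplus> h = \<gamma> g h \<oplus> g)"
  by (simp add: gamma_rho_commute_def perm_mult perm_eq_iff)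

lemma gamma_rho_image: "gamma_rho G \<gamma> = perm ` carrier G"
  by (auto simp: gamma_rho_def)

text \<open>
  The inverse of \<open>\<nu>(g)\<close> must be \<open>\<nu>(h)\<close> with \<open>h\<^sup>\<gamma>\<^sup>(\<^sup>g\<^sup>) + g = 0\<close>, and such an \<open>h\<close> exists because
  \<open>\<gamma>(g)\<close> is onto.
\<close>

lemma subgroup_gamma_rho: "subgroup (gamma_rho G \<gamma>) (Sym G)"
  unfolding gamma_rho_image
proof (rule group.subgroupI[OF group_Sym])
  show "perm ` carrier G \<subseteq> carrier (Sym G)" by (auto simp: perm_Bij)
  show "perm ` carrier G \<noteq> {}" by auto
  fix \<sigma> assume "\<sigma> \<in> perm ` carrier G"
  then obtain g where g: "g \<in> carrier G" "\<sigma> = perm g" by blast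
  obtain h where h: "h \<in> carrier G" "\<gamma> g h = \<ominus> g" using g Bij_onto[OF \<gamma>_Bij] by blast
  have "perm h \<otimes>\<^bsub>Sym G\<^esub> perm g = \<one>\<^bsub>Sym G\<^esub>"
    using g h by (intro Bij_ext[of _ "carrier G"])
      (auto simp: perm_mult Sym_mult_Bij perm_Bij Sym_one id_Bij l_neg perm_apply \<gamma>_zero)
  then have "inv\<^bsub>Sym G\<^esub> \<sigma> = perm h"
    using g h by (auto intro!: group.inv_equality[OF group_Sym] simp: perm_Bij)
  then show "inv\<^bsub>Sym G\<^esub> \<sigma> \<in> perm ` carrier G" using h by simp
  fix \<tau> assume "\<tau> \<in> perm ` carrier G"
  then show "\<sigma> \<otimes>\<^bsub>Sym G\<^esub> \<tau> \<in> perm ` carrier G" using g by (auto simp: perm_mult)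
qed

lemma regular_gamma_rho: "regular_on (carrier G) (gamma_rho G \<gamma>)"
  unfolding regular_on_def gamma_rho_image
proof (intro ballI)
  interpret N: subgroup "perm ` carrier G" "Sym G" using subgroup_gamma_rho by (simp add: gamma_rho_image)
  interpret S: group "Sym G" by (rule group_Sym)
  fix x y assume x: "x \<in> carrier G" and y: "y \<in> carrier G"
  \<comment> \<open>An element sending \<open>x\<close> to \<open>y\<close> must be \<open>\<nu>(x)\<close> inverted, which takes \<open>x\<close> back to \<open>0\<close>,
    followed by \<open>\<nu>(y)\<close>.\<close>
  have *: "\<sigma> x = y \<longleftrightarrow> perm x \<otimes>\<^bsub>Sym G\<^esub> \<sigma> = perm y" if \<sigma>: "\<sigma> \<in> perm ` carrier G" for \<sigma>
  proof -
    have B: "\<sigma> \<in> Bij (carrier G)" using N.subset \<sigma> by auto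
    have "perm x \<otimes>\<^bsub>Sym G\<^esub> \<sigma> \<in> perm ` carrier G" using x \<sigma> by (simp add: N.m_closed)
    then obtain z where z: "z \<in> carrier G" "perm x \<otimes>\<^bsub>Sym G\<^esub> \<sigma> = perm z" by blast
    have "(perm x \<otimes>\<^bsub>Sym G\<^esub> \<sigma>) \<zero> = \<sigma> x" using x B by (simp add: Sym_mult_apply perm_Bij perm_zero)
    then have "\<sigma> x = z" using z by (simp add: perm_zero)
    then show ?thesis using z y by (simp add: perm_eq_iff)
  qed
  let ?s = "inv\<^bsub>Sym G\<^esub> (perm x) \<otimes>\<^bsub>Sym G\<^esub> perm y"
  have c: "perm x \<in> carrier (Sym G)" "perm y \<in> carrier (Sym G)" using x y by (auto simp: perm_Bij)
  show "\<exists>!\<sigma>. \<sigma> \<in> perm ` carrier G \<and> \<sigma> x = y"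
  proof (rule ex1I[of _ ?s])
    have "?s \<in> perm ` carrier G"
      using N.m_closed[OF N.m_inv_closed[OF imageI[OF x, of perm]] imageI[OF y, of perm]] by simp
    moreover have "perm x \<otimes>\<^bsub>Sym G\<^esub> ?s = perm y" using c by (simp add: S.m_assoc[symmetric] del: carrier_Sym)
    ultimately show "?s \<in> perm ` carrier G \<and> ?s x = y" using * by simp
    fix \<sigma> assume "\<sigma> \<in> perm ` carrier G \<and> \<sigma> x = y"
    then have "\<sigma> \<in> carrier (Sym G)" "perm x \<otimes>\<^bsub>Sym G\<^esub> \<sigma> = perm y" using * N.subset by auto
    then show "\<sigma> = ?s" using c by (metis S.inv_solve_left)
  qed
qed

text \<open>
  For an affine \<open>\<sigma> : x \<mapsto> \<beta> x + k\<close>, the rule \<open>\<sigma> \<nu>(g) = \<nu>(g') \<sigma>\<close> compares two affine maps.  Equal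
  constant terms force \<open>\<beta> g' = g - k + k\<^sup>\<gamma>\<^sup>(\<^sup>g\<^sup>)\<close>.  Equal linear parts then require
  \<open>\<gamma>(\<beta> g') = \<gamma>(g)\<close>, which holds because \<open>-k + k\<^sup>\<gamma>\<^sup>(\<^sup>g\<^sup>)\<close> is in the kernel of \<open>\<gamma>\<close>.
\<close>

lemma normal_gamma_rho: "gamma_rho G \<gamma> \<lhd> Hol G"
proof (rule group.normalI_commute[OF group_Hol])
  have "perm g \<in> carrier (Hol G)" if "g \<in> carrier G" for g
    unfolding mem_Hol_iff using that \<gamma>_auto perm_Bij perm_apply by blast
  then have sub: "gamma_rho G \<gamma> \<subseteq> carrier (Hol G)" by (auto simp: gamma_rho_image)
  show "subgroup (gamma_rho G \<gamma>) (Hol G)"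
    using group.subgroup_incl[OF group_Sym subgroup_gamma_rho subgroup_Hol sub] Hol_eq by simp
  fix \<sigma> \<tau> assume \<sigma>: "\<sigma> \<in> carrier (Hol G)" and "\<tau> \<in> gamma_rho G \<gamma>"
  then obtain g where g: "g \<in> carrier G" "\<tau> = perm g" by (auto simp: gamma_rho_image)
  obtain \<beta> k where \<sigma>B: "\<sigma> \<in> Bij (carrier G)" and \<beta>: "\<beta> \<in> add_auto G" and k: "k \<in> carrier G"
    and ap: "\<And>x. x \<in> carrier G \<Longrightarrow> \<sigma> x = \<beta> x \<oplus> k" using \<sigma> unfolding mem_Hol_iff by blast
  obtain g' where g': "g' \<in> carrier G" "\<beta> g' = g \<oplus> (\<ominus> k \<oplus> \<gamma> g k)"
    using g(1) k Bij_onto[OF add_auto_Bij[OF \<beta>], of "g \<oplus> (\<ominus> k \<oplus> \<gamma> g k)"] by auto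
  have "perm g (\<sigma> x) = \<sigma> (perm g' x)" if x: "x \<in> carrier G" for x
  proof -
    have \<beta>x: "\<beta> x \<in> carrier G" using \<beta> x by (rule add_auto_closed)
    have "perm g (\<sigma> x) = \<gamma> g (\<beta> x) \<oplus> \<gamma> g k \<oplus> g"
      using g k x \<beta>x by (simp add: ap perm_apply add_auto_add[OF \<gamma>_auto])
    also have "\<gamma> g (\<beta> x) = \<gamma> (\<beta> g') (\<beta> x)"
      using \<gamma>_add[of g "\<ominus> k \<oplus> \<gamma> g k" "\<beta> x"] \<gamma>_kernel[of k g "\<gamma> g (\<beta> x)"] g(1) k \<beta>x
      by (simp add: g'(2))
    also have "\<dots> = \<beta> (\<gamma> g' x)" using \<gamma>_equivariant[of g' \<beta> x] g'(1) \<beta> x by simp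
    also have "\<beta> (\<gamma> g' x) \<oplus> \<gamma> g k \<oplus> g = \<beta> (\<gamma> g' x) \<oplus> \<beta> g' \<oplus> k"
      using g k g' x add_auto_closed[OF \<beta>] by (simp add: a_ac r_neg1 r_neg2)
    also have "\<dots> = \<sigma> (perm g' x)"
      using g' x by (simp add: ap perm_apply add_auto_add[OF \<beta>])
    finally show ?thesis .
  qed
  then have "\<sigma> \<otimes>\<^bsub>Hol G\<^esub> \<tau> = perm g' \<otimes>\<^bsub>Hol G\<^esub> \<sigma>"
    using \<sigma>B g g' by (simp add: mult_Hol Sym_mult_eq_iff perm_Bij)
  then show "\<exists>\<tau>'\<in>gamma_rho G \<gamma>. \<sigma> \<otimes>\<^bsub>Hol G\<^esub> \<tau> = \<tau>' \<otimes>\<^bsub>Hol G\<^esub> \<sigma>" using g' by (auto simp: gamma_rho_image)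
qed

lemma gamma_rho_regular_normal: "gamma_rho G \<gamma> \<in> regular_normal G"
  by (simp add: regular_normal_def subgroup_gamma_rho regular_gamma_rho normal_gamma_rho)

lemma gamma_rho_data1:
  assumes "gamma_rho_commute G \<gamma>"
  shows "gamma_rho G \<gamma> \<in> data1 G"
proof -
  have "comm_group ((Sym G)\<lparr>carrier := gamma_rho G \<gamma>\<rparr>)"
  proof (rule group.group_comm_groupI[OF group.subgroup_imp_group[OF group_Sym subgroup_gamma_rho]])
    fix \<sigma> \<tau> assume "\<sigma> \<in> carrier ((Sym G)\<lparr>carrier := gamma_rho G \<gamma>\<rparr>)"
      "\<tau> \<in> carrier ((Sym G)\<lparr>carrier := gamma_rho G \<gamma>\<rparr>)"
    then show "\<sigma> \<otimes>\<^bsub>(Sym G)\<lparr>carrier := gamma_rho G \<gamma>\<rparr>\<^esub> \<tau> = \<tau> \<otimes>\<^bsub>(Sym G)\<lparr>carrier := gamma_rho G \<gamma>\<rparr>\<^esub> \<sigma>"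
      using assms by (auto simp: gamma_rho_image gamma_rho_commute_def)
  qed
  then show ?thesis by (simp add: data1_def gamma_rho_regular_normal)
qed

lemma nu_gamma_rho: "g \<in> carrier G \<Longrightarrow> nu G (gamma_rho G \<gamma>) g = perm g"
  unfolding nu_def gamma_rho_image by (rule the_equality) (auto simp: perm_zero)

abbreviation R where "R \<equiv> with_mult G (gamma_mult G \<gamma>)"

lemma gamma_mult_eq:
  "\<lbrakk>g \<in> carrier G; h \<in> carrier G\<rbrakk> \<Longrightarrow> gamma_mult G \<gamma> g h = \<ominus> g \<oplus> \<gamma> h g"
  by (simp add: gamma_mult_def)

lemma circ_mult:
  assumes "g \<in> carrier G" "h \<in> carrier G"
  shows "g \<otimes>\<^bsub>circ R\<^esub> h = \<gamma> h g \<oplus> h"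
proof -
  have "g \<oplus> h \<oplus> (\<ominus> g \<oplus> \<gamma> h g) = h \<oplus> (g \<oplus> (\<ominus> g \<oplus> \<gamma> h g))"
    using assms by (simp add: a_ac)
  also have "\<dots> = \<gamma> h g \<oplus> h" using assms by (simp add: r_neg2 a_comm)
  finally show ?thesis using assms by (simp add: circ_def gamma_mult_eq)
qed

lemma carrier_circ: "carrier (circ R) = carrier G"
  by (simp add: circ_def)

lemma nu_iso: "nu G (gamma_rho G \<gamma>) \<in> iso (circ R) ((Sym G)\<lparr>carrier := gamma_rho G \<gamma>\<rparr>)"
proof (rule isoI)
  have perm_mem: "perm g \<in> gamma_rho G \<gamma>" if "g \<in> carrier G" for g
    using that by (auto simp: gamma_rho_def)
  show "nu G (gamma_rho G \<gamma>) \<in> hom (circ R) ((Sym G)\<lparr>carrier := gamma_rho G \<gamma>\<rparr>)"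
    by (rule homI) (simp_all add: carrier_circ nu_gamma_rho circ_mult perm_mult perm_mem)
  have "nu G (gamma_rho G \<gamma>) ` carrier G = gamma_rho G \<gamma>"
  proof -
    have "nu G (gamma_rho G \<gamma>) ` carrier G = perm ` carrier G"
      by (rule image_cong) (simp_all add: nu_gamma_rho)
    then show ?thesis by (simp only: gamma_rho_image)
  qed
  then show "bij_betw (nu G (gamma_rho G \<gamma>)) (carrier (circ R)) (carrier ((Sym G)\<lparr>carrier := gamma_rho G \<gamma>\<rparr>))"
    by (simp add: bij_betw_def inj_on_def carrier_circ nu_gamma_rho perm_eq_iff)
qed

lemma add_auto_circ: "add_auto G \<subseteq> auto (circ R)"
proof
  fix \<beta> assume \<beta>: "\<beta> \<in> add_auto G"
  have "\<beta> \<in> hom (circ R) (circ R)"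
    using add_auto_closed[OF \<beta>]
    by (intro homI) (simp_all add: carrier_circ circ_mult add_auto_add[OF \<beta>] \<gamma>_equivariant[OF _ \<beta>])
  then show "\<beta> \<in> auto (circ R)" by (simp add: auto_def carrier_circ add_auto_Bij[OF \<beta>])
qed

lemma group_circ: "group (circ R)"
proof (rule groupI)
  show "\<one>\<^bsub>circ R\<^esub> \<in> carrier (circ R)" by (simp add: circ_def)
  fix g assume g: "g \<in> carrier (circ R)"
  then show "\<one>\<^bsub>circ R\<^esub> \<otimes>\<^bsub>circ R\<^esub> g = g"
    by (simp add: carrier_circ) (simp add: circ_def gamma_mult_eq add_auto_zero[OF \<gamma>_auto])
  obtain h where "h \<in> carrier G" "\<gamma> g h = \<ominus> g"
    using g Bij_onto[OF \<gamma>_Bij, of g "\<ominus> g"] by (auto simp: carrier_circ)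
  then show "\<exists>h\<in>carrier (circ R). h \<otimes>\<^bsub>circ R\<^esub> g = \<one>\<^bsub>circ R\<^esub>"
    using g by (intro bexI[of _ h]) (simp_all add: carrier_circ circ_mult l_neg, simp add: circ_def)
next
  fix x y assume "x \<in> carrier (circ R)" "y \<in> carrier (circ R)"
  then show "x \<otimes>\<^bsub>circ R\<^esub> y \<in> carrier (circ R)" by (simp add: carrier_circ circ_mult)
next
  fix x y z assume "x \<in> carrier (circ R)" "y \<in> carrier (circ R)" "z \<in> carrier (circ R)"
  then show "x \<otimes>\<^bsub>circ R\<^esub> y \<otimes>\<^bsub>circ R\<^esub> z = x \<otimes>\<^bsub>circ R\<^esub> (y \<otimes>\<^bsub>circ R\<^esub> z)"
    by (simp add: carrier_circ circ_mult \<gamma>_mult add_auto_add[OF \<gamma>_auto] a_assoc)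
qed

end


section \<open>Ring structures invariant under all automorphisms\<close>

context abelian_group
begin

lemma abelian_group_with_mult: "abelian_group (with_mult G m)"
  using abelian_group_axioms by (simp add: abelian_group_def abelian_monoid_def abelian_group_axioms_def)

lemma data2_eqI:
  assumes "\<gamma> \<in> data2 G" "\<gamma>' \<in> data2 G"
    and "\<And>g x. \<lbrakk>g \<in> carrier G; x \<in> carrier G\<rbrakk> \<Longrightarrow> \<gamma> g x = \<gamma>' g x"
  shows "\<gamma> = \<gamma>'"
proof (rule extensionalityI)
  show "\<gamma> \<in> extensional (carrier G)" "\<gamma>' \<in> extensional (carrier G)" using assms by (auto simp: data2_iff)
  fix g assume "g \<in> carrier G"
  then show "\<gamma> g = \<gamma>' g"
    using assms by (intro Bij_ext[of _ "carrier G"]) (auto simp: data2_iff intro: add_auto_Bij)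
qed

lemma data3_eqI:
  assumes "m \<in> extensional (carrier G)" "m' \<in> extensional (carrier G)"
    and "\<And>g. g \<in> carrier G \<Longrightarrow> m g \<in> extensional (carrier G)"
    and "\<And>g. g \<in> carrier G \<Longrightarrow> m' g \<in> extensional (carrier G)"
    and "\<And>g h. \<lbrakk>g \<in> carrier G; h \<in> carrier G\<rbrakk> \<Longrightarrow> m g h = m' g h"
  shows "m = m'"
  using assms by (intro extensionalityI[of m "carrier G" m'] extensionalityI[of "m g" "carrier G" "m' g" for g])

end

context equivariant_hom
begin

lemma gamma_mult_extensional:
  "gamma_mult G \<gamma> \<in> extensional (carrier G)"
  "g \<in> carrier G \<Longrightarrow> gamma_mult G \<gamma> g \<in> extensional (carrier G)"
  by (simp_all add: gamma_mult_def)

text \<open>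
  Commutativity of the ring is that of \<open>\<circ>\<close>, and additivity in the first factor is that of the
  automorphisms \<open>\<gamma>(k)\<close>.  Products act trivially, so \<open>k(gh) = -k + k = 0\<close>, and
  associativity holds because both sides vanish.
\<close>

lemma gamma_mult_data3:
  assumes comm: "gamma_rho_commute G \<gamma>"
  shows "gamma_mult G \<gamma> \<in> data3 G"
proof -
  let ?m = "gamma_mult G \<gamma>"
  have closed: "?m g h \<in> carrier G" if "g \<in> carrier G" "h \<in> carrier G" for g h
    using that by (simp add: gamma_mult_eq)
  have m_comm: "?m g h = ?m h g" if gh: "g \<in> carrier G" "h \<in> carrier G" for g h
  proof -
    have "g \<otimes>\<^bsub>circ R\<^esub> h = h \<otimes>\<^bsub>circ R\<^esub> g"
      using gh comm by (simp add: circ_mult gamma_rho_commute_iff)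
    then have "g \<oplus> h \<oplus> ?m g h = g \<oplus> h \<oplus> ?m h g"
      using gh by (simp add: circ_def a_comm)
    then show ?thesis using gh closed by simp
  qed
  have distr: "?m (g \<oplus> h) k = ?m g k \<oplus> ?m h k"
    if "g \<in> carrier G" "h \<in> carrier G" "k \<in> carrier G" for g h k
    using that by (simp add: gamma_mult_eq add_auto_add[OF \<gamma>_auto] minus_add a_ac)
  have nil: "?m (?m g h) k = \<zero>" if ghk: "g \<in> carrier G" "h \<in> carrier G" "k \<in> carrier G" for g h k
  proof -
    have "?m (?m g h) k = ?m k (?m g h)" using ghk closed by (intro m_comm)
    also have "\<dots> = \<ominus> k \<oplus> \<gamma> (\<ominus> g \<oplus> \<gamma> h g) k" using ghk by (simp add: gamma_mult_eq)
    also have "\<dots> = \<zero>" using ghk by (simp add: \<gamma>_kernel l_neg)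
    finally show ?thesis .
  qed
  have "comm_rng R"
  proof (intro comm_rng.intro comm_rng_axioms.intro abelian_group_with_mult)
    fix x y z assume "x \<in> carrier R" "y \<in> carrier R" "z \<in> carrier R"
    then have xyz: "x \<in> carrier G" "y \<in> carrier G" "z \<in> carrier G" by simp_all
    then have "?m x (?m y z) = ?m (?m y z) x" using closed by (intro m_comm)
    then show "x \<otimes>\<^bsub>R\<^esub> y \<otimes>\<^bsub>R\<^esub> z = x \<otimes>\<^bsub>R\<^esub> (y \<otimes>\<^bsub>R\<^esub> z)" using xyz by (simp add: nil)
    show "x \<otimes>\<^bsub>R\<^esub> y = y \<otimes>\<^bsub>R\<^esub> x" using m_comm[OF xyz(1,2)] by simp
  qed (simp_all add: closed distr)
  moreover have "add_auto G \<subseteq> rng_auto R"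
  proof
    fix \<beta> assume \<beta>: "\<beta> \<in> add_auto G"
    have "\<beta> \<in> hom R R"
      using add_auto_closed[OF \<beta>]
      by (intro homI) (simp_all add: gamma_mult_eq add_auto_add[OF \<beta>] add_auto_minus[OF \<beta>] \<gamma>_equivariant[OF _ \<beta>])
    then show "\<beta> \<in> rng_auto R" using \<beta> by (simp add: rng_auto_def) (simp add: auto_def)
  qed
  ultimately show ?thesis
    by (simp add: data3_def gamma_mult_extensional group_circ nil)
qed

end

locale invariant_mult = abelian_group G for G :: "('a, 'b) ring_scheme" (structure) +
  fixes m :: "'a \<Rightarrow> 'a \<Rightarrow> 'a"
  assumes m_data3: "m \<in> data3 G"
begin

lemma comm_rng_m: "comm_rng (with_mult G m)"
  using m_data3 by (simp add: data3_def)

lemma m_closed [simp]: "\<lbrakk>g \<in> carrier G; h \<in> carrier G\<rbrakk> \<Longrightarrow> m g h \<in> carrier G"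
  using comm_rng.m_closed[OF comm_rng_m] by simp

lemma m_comm: "\<lbrakk>g \<in> carrier G; h \<in> carrier G\<rbrakk> \<Longrightarrow> m g h = m h g"
  using comm_rng.m_comm[OF comm_rng_m] by simp

lemma m_add_left:
  "\<lbrakk>g \<in> carrier G; h \<in> carrier G; k \<in> carrier G\<rbrakk> \<Longrightarrow> m (g \<oplus> h) k = m g k \<oplus> m h k"
  using comm_rng.l_distr[OF comm_rng_m] by simp

lemma m_add_right:
  "\<lbrakk>g \<in> carrier G; h \<in> carrier G; k \<in> carrier G\<rbrakk> \<Longrightarrow> m k (g \<oplus> h) = m k g \<oplus> m k h"
  by (simp add: m_comm[of k] m_add_left)

lemma m_nil: "\<lbrakk>g \<in> carrier G; h \<in> carrier G; k \<in> carrier G\<rbrakk> \<Longrightarrow> m (m g h) k = \<zero>"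
  using m_data3 by (simp add: data3_def)

lemma m_auto:
  "\<lbrakk>\<beta> \<in> add_auto G; g \<in> carrier G; h \<in> carrier G\<rbrakk> \<Longrightarrow> \<beta> (m g h) = m (\<beta> g) (\<beta> h)"
proof -
  assume \<beta>: "\<beta> \<in> add_auto G" and gh: "g \<in> carrier G" "h \<in> carrier G"
  have "\<beta> \<in> rng_auto (with_mult G m)" using m_data3 \<beta> by (auto simp: data3_def)
  then have "\<beta> \<in> hom (with_mult G m) (with_mult G m)" by (simp add: rng_auto_def) (simp add: auto_def)
  from hom_mult[OF this] show ?thesis using gh by simp
qed

lemma m_minus_left:
  assumes "g \<in> carrier G" "h \<in> carrier G" shows "m (\<ominus> g) h = \<ominus> m g h"
proof -
  have z: "m \<zero> h = \<zero>"
    using m_add_left[of \<zero> \<zero> h] assms by (metis add.r_cancel_one' m_closed zero_closed r_zero)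
  have "m (\<ominus> g) h \<oplus> m g h = \<zero>"
    using m_add_left[of "\<ominus> g" g h] assms by (simp add: l_neg z)
  then show ?thesis using assms by (intro minus_equality[symmetric]) simp_all
qed

definition mult_gamma :: "'a \<Rightarrow> 'a \<Rightarrow> 'a" where
  "mult_gamma = (\<lambda>g\<in>carrier G. \<lambda>h\<in>carrier G. h \<oplus> m h g)"

lemma mult_gamma_apply:
  "\<lbrakk>g \<in> carrier G; h \<in> carrier G\<rbrakk> \<Longrightarrow> mult_gamma g h = h \<oplus> m h g"
  by (simp add: mult_gamma_def)

text \<open>
  Multiplying \<open>y = x + xg\<close> by \<open>g\<close> gives \<open>yg = xg\<close>, since \<open>xgg = 0\<close>; hence \<open>x = y - yg\<close> is the only
  preimage of \<open>y\<close>.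
\<close>

lemma mult_gamma_auto:
  assumes g: "g \<in> carrier G"
  shows "mult_gamma g \<in> add_auto G"
proof (rule add_autoI)
  show "mult_gamma g \<in> Bij (carrier G)"
  proof (rule BijI)
    show "mult_gamma g \<in> extensional (carrier G)" using g by (simp add: mult_gamma_def)
    show "mult_gamma g x \<in> carrier G" if "x \<in> carrier G" for x
      using g that by (simp add: mult_gamma_apply)
    show "x = y" if xy: "x \<in> carrier G" "y \<in> carrier G" and eq: "mult_gamma g x = mult_gamma g y" for x y
    proof -
      have "m (x \<oplus> m x g) g = m (y \<oplus> m y g) g" using eq xy g by (simp add: mult_gamma_apply)
      then have "m x g = m y g" using xy g by (simp add: m_add_left m_nil)
      then show ?thesis using eq xy g by (simp add: mult_gamma_apply)
    qed
    show "\<exists>x\<in>carrier G. mult_gamma g x = y" if y: "y \<in> carrier G" for y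
    proof
      have minus_zero: "\<ominus> \<zero> = \<zero>" using l_neg[of \<zero>] by simp
      show "y \<oplus> \<ominus> m y g \<in> carrier G" using y g by simp
      then show "mult_gamma g (y \<oplus> \<ominus> m y g) = y"
        using y g by (simp add: mult_gamma_apply m_add_left m_minus_left m_nil minus_zero a_assoc l_neg)
    qed
  qed
qed (use g in \<open>simp add: mult_gamma_apply m_add_left a_ac\<close>)

lemma mult_gamma_data2: "mult_gamma \<in> data2 G"
  unfolding data2_iff
proof (intro conjI ballI)
  show "mult_gamma \<in> extensional (carrier G)" by (simp add: mult_gamma_def)
  show "mult_gamma g \<in> add_auto G" if "g \<in> carrier G" for g using that by (rule mult_gamma_auto)
  fix g x assume g: "g \<in> carrier G" and x: "x \<in> carrier G"
  show "mult_gamma (g \<oplus> h) x = mult_gamma h (mult_gamma g x)" if "h \<in> carrier G" for h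
    using g x that by (simp add: mult_gamma_apply m_add_left m_add_right m_nil a_ac)
  show "\<beta> (mult_gamma g x) = mult_gamma (\<beta> g) (\<beta> x)" if \<beta>: "\<beta> \<in> add_auto G" for \<beta>
    using g x add_auto_closed[OF \<beta>] by (simp add: mult_gamma_apply add_auto_add[OF \<beta>] m_auto[OF \<beta>])
qed

lemma mult_gamma_commute: "gamma_rho_commute G mult_gamma"
proof -
  interpret equivariant_hom G mult_gamma by unfold_locales (rule mult_gamma_data2)
  show ?thesis
    unfolding gamma_rho_commute_iff by (simp add: mult_gamma_apply) (simp add: m_comm a_ac)
qed

lemma gamma_mult_mult_gamma: "gamma_mult G mult_gamma = m"
proof -
  interpret equivariant_hom G mult_gamma by unfold_locales (rule mult_gamma_data2)
  show ?thesis
    using m_data3 gamma_mult_extensional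
    by (intro data3_eqI) (auto simp: data3_def gamma_mult_eq mult_gamma_apply r_neg1)
qed

end


section \<open>From regular subgroups to homomorphisms\<close>

context abelian_group
begin

text \<open>
  The linear parts of the permutations in \<open>N\<close> give \<open>\<gamma>\<close>.  Each property of \<open>\<gamma>\<close> is found by
  comparing two elements of \<open>N\<close> with the same value at \<open>0\<close>, which regularity makes equal.
\<close>

lemma data1_imp_data2:
  assumes N: "N \<in> data1 G"
  shows "\<exists>\<gamma>\<in>data2 G. gamma_rho_commute G \<gamma> \<and> gamma_rho G \<gamma> = N"
proof -
  interpret S: group "Sym G" by (rule group_Sym)
  interpret N: subgroup N "Sym G" using N by (simp add: data1_def regular_normal_def)
  have normal: "N \<lhd> Hol G" using N by (simp add: data1_def regular_normal_def)
  have NB: "\<sigma> \<in> Bij (carrier G)" if "\<sigma> \<in> N" for \<sigma> using that N.subset by auto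
  have NH: "\<sigma> \<in> carrier (Hol G)" if "\<sigma> \<in> N" for \<sigma>
    using that normal_imp_subgroup[OF normal] subgroup.subset by blast
  have N_comm: "\<sigma> \<otimes>\<^bsub>Sym G\<^esub> \<tau> = \<tau> \<otimes>\<^bsub>Sym G\<^esub> \<sigma>" if "\<sigma> \<in> N" "\<tau> \<in> N" for \<sigma> \<tau>
  proof -
    have "comm_group ((Sym G)\<lparr>carrier := N\<rparr>)" using N by (simp add: data1_def)
    from comm_monoid.m_comm[OF comm_group.axioms(1)[OF this], of \<sigma> \<tau>] show ?thesis using that by simp
  qed
  define \<nu> where "\<nu> = nu G N"
  have ex1: "\<exists>!\<sigma>. \<sigma> \<in> N \<and> \<sigma> \<zero> = g" if "g \<in> carrier G" for g
    using N that by (simp add: data1_def regular_normal_def regular_on_def)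
  have \<nu>N: "\<nu> g \<in> N" and \<nu>0: "\<nu> g \<zero> = g" if "g \<in> carrier G" for g
    using theI'[OF ex1[OF that]] by (simp_all add: \<nu>_def nu_def)
  have \<nu>_unique: "\<sigma> = \<nu> g" if "\<sigma> \<in> N" "\<sigma> \<zero> = g" "g \<in> carrier G" for \<sigma> g
    using ex1[of g] \<nu>N[of g] \<nu>0[of g] that by blast
  define \<gamma> where "\<gamma> = (\<lambda>g\<in>carrier G. \<nu> g \<otimes>\<^bsub>Sym G\<^esub> rho G (\<ominus> g))"
  have \<gamma>: "\<gamma> g \<in> add_auto G \<and> (\<forall>x\<in>carrier G. \<nu> g x = \<gamma> g x \<oplus> g)" if g: "g \<in> carrier G" for g
  proof -
    obtain \<beta> k where \<beta>: "\<beta> \<in> add_auto G" and k: "k \<in> carrier G"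
      and ap: "\<And>x. x \<in> carrier G \<Longrightarrow> \<nu> g x = \<beta> x \<oplus> k"
      using NH[OF \<nu>N[OF g]] unfolding mem_Hol_iff by blast
    have "k = g" using ap[of \<zero>] \<nu>0[OF g] k by (simp add: add_auto_zero[OF \<beta>])
    have "\<gamma> g = \<beta>"
    proof (rule Bij_ext[of _ "carrier G"])
      show "\<gamma> g \<in> Bij (carrier G)" using g by (simp add: \<gamma>_def mult_rho_Bij NB \<nu>N)
      fix x assume x: "x \<in> carrier G"
      then show "\<gamma> g x = \<beta> x"
        using g by (simp add: \<gamma>_def mult_rho_apply NB \<nu>N ap \<open>k = g\<close> add_auto_closed[OF \<beta>] a_assoc r_neg)
    qed (rule add_auto_Bij[OF \<beta>])
    then show ?thesis using \<beta> ap \<open>k = g\<close> by simp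
  qed
  have \<gamma>_auto: "\<gamma> g \<in> add_auto G" if "g \<in> carrier G" for g using \<gamma>[OF that] by simp
  have \<nu>_apply: "\<nu> g x = \<gamma> g x \<oplus> g" if "g \<in> carrier G" "x \<in> carrier G" for g x using \<gamma> that by simp
  have cl: "\<gamma> g x \<in> carrier G" if "g \<in> carrier G" "x \<in> carrier G" for g x
    using \<gamma>_auto[OF that(1)] that(2) by (rule add_auto_closed)
  \<comment> \<open>Products in \<open>N\<close>: both sides send \<open>0\<close> to \<open>g\<^sup>\<gamma>\<^sup>(\<^sup>h\<^sup>) + h\<close>; then compare linear parts.\<close>
  have \<gamma>_mult: "\<gamma> (\<gamma> h g \<oplus> h) x = \<gamma> h (\<gamma> g x)"
    if "g \<in> carrier G" "h \<in> carrier G" "x \<in> carrier G" for g h x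
  proof -
    have "(\<nu> g \<otimes>\<^bsub>Sym G\<^esub> \<nu> h) \<zero> = \<gamma> h g \<oplus> h"
      using that by (simp add: Sym_mult_apply NB \<nu>N \<nu>0) (simp add: \<nu>_apply)
    then have "\<nu> g \<otimes>\<^bsub>Sym G\<^esub> \<nu> h = \<nu> (\<gamma> h g \<oplus> h)"
      using that by (intro \<nu>_unique) (simp_all add: \<nu>N cl N.m_closed)
    moreover have "(\<nu> g \<otimes>\<^bsub>Sym G\<^esub> \<nu> h) x = \<gamma> h (\<gamma> g x) \<oplus> (\<gamma> h g \<oplus> h)"
      using that by (simp add: Sym_mult_apply NB \<nu>N \<nu>_apply cl add_auto_add[OF \<gamma>_auto] a_assoc)
    ultimately show ?thesis using that by (simp add: \<nu>_apply cl)
  qed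
  \<comment> \<open>Since \<open>N\<close> is abelian, the argument of \<open>\<gamma>\<close> in this product rule is symmetric in \<open>g\<close> and \<open>h\<close>,
    so the values of \<open>\<gamma>\<close> commute.\<close>
  have \<gamma>_swap: "\<gamma> h g \<oplus> h = \<gamma> g h \<oplus> g" if "g \<in> carrier G" "h \<in> carrier G" for g h
  proof -
    have "(\<nu> g \<otimes>\<^bsub>Sym G\<^esub> \<nu> h) \<zero> = (\<nu> h \<otimes>\<^bsub>Sym G\<^esub> \<nu> g) \<zero>"
      by (simp only: N_comm[OF \<nu>N[OF that(1)] \<nu>N[OF that(2)]])
    then show ?thesis using that by (simp add: Sym_mult_apply NB \<nu>N \<nu>0) (simp add: \<nu>_apply)
  qed
  have \<gamma>_commute: "\<gamma> h (\<gamma> g x) = \<gamma> g (\<gamma> h x)"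
    if "g \<in> carrier G" "h \<in> carrier G" "x \<in> carrier G" for g h x
  proof -
    have "\<gamma> h (\<gamma> g x) = \<gamma> (\<gamma> h g \<oplus> h) x" by (rule \<gamma>_mult[OF that, symmetric])
    also have "\<dots> = \<gamma> (\<gamma> g h \<oplus> g) x" by (simp only: \<gamma>_swap[OF that(1,2)])
    also have "\<dots> = \<gamma> g (\<gamma> h x)" by (rule \<gamma>_mult[OF that(2,1,3)])
    finally show ?thesis .
  qed
  \<comment> \<open>Normality: conjugating \<open>\<nu>(g)\<close> by \<open>\<beta>\<close> gives the element of \<open>N\<close> that sends \<open>0\<close> to \<open>g\<^sup>\<beta>\<close>.\<close>
  have \<gamma>_equivariant: "\<beta> (\<gamma> g x) = \<gamma> (\<beta> g) (\<beta> x)"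
    if g: "g \<in> carrier G" and \<beta>: "\<beta> \<in> add_auto G" and x: "x \<in> carrier G" for g \<beta> x
  proof -
    note B = add_auto_Bij[OF \<beta>] and \<beta>c = add_auto_closed[OF \<beta>]
    obtain \<tau> where \<tau>: "\<tau> \<in> N" "\<nu> g \<otimes>\<^bsub>Sym G\<^esub> \<beta> = \<beta> \<otimes>\<^bsub>Sym G\<^esub> \<tau>"
      using normal_commute[OF normal add_auto_mem_Hol[OF \<beta>] \<nu>N[OF g]] by (auto simp: mult_Hol)
    then have eq: "\<beta> (\<nu> g y) = \<tau> (\<beta> y)" if "y \<in> carrier G" for y
      using that Sym_mult_eq_iff[OF NB[OF \<nu>N[OF g]] B B NB[OF \<tau>(1)]] by simp
    have "\<tau> \<zero> = \<beta> g" using eq[of \<zero>] g by (simp add: add_auto_zero[OF \<beta>] \<nu>0)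
    then have "\<tau> = \<nu> (\<beta> g)" by (rule \<nu>_unique[OF \<tau>(1) _ \<beta>c[OF g]])
    then have "\<beta> (\<gamma> g x) \<oplus> \<beta> g = \<gamma> (\<beta> g) (\<beta> x) \<oplus> \<beta> g"
      using eq[OF x] g x \<beta>c by (simp add: \<nu>_apply add_auto_add[OF \<beta>] cl)
    then show ?thesis using g x \<beta>c cl by simp
  qed
  \<comment> \<open>With \<open>g = g'\<^sup>\<gamma>\<^sup>(\<^sup>h\<^sup>)\<close> the product rule gives \<open>\<gamma>(g + h) = \<gamma>(g')\<gamma>(h)\<close>, and \<open>\<gamma>(g) = \<gamma>(g')\<close> by
    equivariance under \<open>\<gamma>(h)\<close>.\<close>
  have \<gamma>_add: "\<gamma> (g \<oplus> h) x = \<gamma> h (\<gamma> g x)"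
    if g: "g \<in> carrier G" and h: "h \<in> carrier G" and x: "x \<in> carrier G" for g h x
  proof -
    note onto = Bij_onto[OF add_auto_Bij[OF \<gamma>_auto[OF h]]]
    obtain g' where g': "g' \<in> carrier G" "\<gamma> h g' = g" using onto[OF g] by blast
    have \<gamma>_eq: "\<gamma> g y = \<gamma> g' y" if y: "y \<in> carrier G" for y
    proof -
      obtain z where z: "z \<in> carrier G" "\<gamma> h z = y" using onto[OF y] by blast
      have "\<gamma> g (\<gamma> h z) = \<gamma> h (\<gamma> g' z)" using \<gamma>_equivariant[OF g'(1) \<gamma>_auto[OF h] z(1)] g' by simp
      then show ?thesis using \<gamma>_commute[OF g'(1) h z(1)] z by simp
    qed
    show ?thesis using \<gamma>_mult[OF g'(1) h x] g' \<gamma>_eq[OF x] by simp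
  qed
  have "\<gamma> \<in> extensional (carrier G)" by (simp add: \<gamma>_def)
  then have d2: "\<gamma> \<in> data2 G"
    unfolding data2_iff using \<gamma>_auto \<gamma>_add \<gamma>_equivariant by blast
  have perm: "\<gamma> g \<otimes>\<^bsub>Sym G\<^esub> rho G g = \<nu> g" if "g \<in> carrier G" for g
    using that by (intro Bij_ext[of _ "carrier G"])
      (simp_all add: mult_rho_Bij mult_rho_apply add_auto_Bij[OF \<gamma>_auto] NB \<nu>N \<nu>_apply)
  have "gamma_rho_commute G \<gamma>"
    unfolding gamma_rho_commute_def
  proof (intro ballI)
    fix g h assume g: "g \<in> carrier G" and h: "h \<in> carrier G"
    show "(\<gamma> g \<otimes>\<^bsub>Sym G\<^esub> rho G g) \<otimes>\<^bsub>Sym G\<^esub> (\<gamma> h \<otimes>\<^bsub>Sym G\<^esub> rho G h)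
      = (\<gamma> h \<otimes>\<^bsub>Sym G\<^esub> rho G h) \<otimes>\<^bsub>Sym G\<^esub> (\<gamma> g \<otimes>\<^bsub>Sym G\<^esub> rho G g)"
      unfolding perm[OF g] perm[OF h] by (rule N_comm[OF \<nu>N[OF g] \<nu>N[OF h]])
  qed
  moreover have "gamma_rho G \<gamma> = N"
  proof -
    have "gamma_rho G \<gamma> = (\<lambda>g. \<gamma> g \<otimes>\<^bsub>Sym G\<^esub> rho G g) ` carrier G"
      unfolding gamma_rho_def by (rule Setcompr_eq_image)
    also have "\<dots> = \<nu> ` carrier G" by (intro image_cong refl perm)
    also have "\<dots> = N"
    proof
      show "\<nu> ` carrier G \<subseteq> N" by (intro image_subsetI \<nu>N)
      show "N \<subseteq> \<nu> ` carrier G"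
      proof
        fix \<sigma> assume \<sigma>: "\<sigma> \<in> N"
        have 0: "\<sigma> \<zero> \<in> carrier G" by (rule Bij_closed[OF NB[OF \<sigma>] zero_closed])
        show "\<sigma> \<in> \<nu> ` carrier G" by (rule image_eqI[of _ \<nu>, OF \<nu>_unique[OF \<sigma> refl 0] 0])
      qed
    qed
    finally show ?thesis .
  qed
  ultimately show ?thesis by (intro bexI[OF _ d2] conjI)
qed

end


section \<open>The correspondences\<close>

context abelian_group
begin

text \<open>The subgroup recovers \<open>\<nu>(g)\<close> as its element with value \<open>g\<close> at \<open>0\<close>, and \<open>\<nu>(g)\<close> recovers its linear
  part.\<close>

lemma inj_on_gamma_rho: "inj_on (gamma_rho G) (data2 G)"
proof (rule inj_onI)
  fix \<gamma> \<gamma>' assume d: "\<gamma> \<in> data2 G" "\<gamma>' \<in> data2 G" and eq: "gamma_rho G \<gamma> = gamma_rho G \<gamma>'"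
  interpret E: equivariant_hom G \<gamma> by unfold_locales (rule d)
  interpret E': equivariant_hom G \<gamma>' by unfold_locales (rule d)
  show "\<gamma> = \<gamma>'"
  proof (rule data2_eqI[OF d])
    fix g x assume gx: "g \<in> carrier G" "x \<in> carrier G"
    then have "E.perm g x = E'.perm g x" using eq E.nu_gamma_rho E'.nu_gamma_rho by metis
    then show "\<gamma> g x = \<gamma>' g x" using gx by (simp add: E.perm_apply E'.perm_apply)
  qed
qed

lemma inj_on_gamma_mult: "inj_on (gamma_mult G) (data2 G)"
proof (rule inj_onI)
  fix \<gamma> \<gamma>' assume d: "\<gamma> \<in> data2 G" "\<gamma>' \<in> data2 G" and eq: "gamma_mult G \<gamma> = gamma_mult G \<gamma>'"
  interpret E: equivariant_hom G \<gamma> by unfold_locales (rule d)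
  interpret E': equivariant_hom G \<gamma>' by unfold_locales (rule d)
  show "\<gamma> = \<gamma>'"
  proof (rule data2_eqI[OF d])
    fix g x assume gx: "g \<in> carrier G" "x \<in> carrier G"
    then have "gamma_mult G \<gamma> x g = gamma_mult G \<gamma>' x g" using eq by simp
    then show "\<gamma> g x = \<gamma>' g x" using gx by (simp add: E.gamma_mult_eq E'.gamma_mult_eq)
  qed
qed

lemma bij_betw_gamma_rho:
  "bij_betw (gamma_rho G) {\<gamma> \<in> data2 G. gamma_rho_commute G \<gamma>} (data1 G)"
  unfolding bij_betw_def
proof
  show "gamma_rho G ` {\<gamma> \<in> data2 G. gamma_rho_commute G \<gamma>} = data1 G"
  proof
    show "gamma_rho G ` {\<gamma> \<in> data2 G. gamma_rho_commute G \<gamma>} \<subseteq> data1 G"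
      by (auto intro!: equivariant_hom.gamma_rho_data1 equivariant_hom.intro equivariant_hom_axioms.intro
          abelian_group_axioms)
    show "data1 G \<subseteq> gamma_rho G ` {\<gamma> \<in> data2 G. gamma_rho_commute G \<gamma>}"
      using data1_imp_data2 by fast
  qed
qed (rule inj_on_subset[OF inj_on_gamma_rho], blast)

lemma bij_betw_gamma_mult:
  "bij_betw (gamma_mult G) {\<gamma> \<in> data2 G. gamma_rho_commute G \<gamma>} (data3 G)"
  unfolding bij_betw_def
proof
  show "gamma_mult G ` {\<gamma> \<in> data2 G. gamma_rho_commute G \<gamma>} = data3 G"
  proof
    show "gamma_mult G ` {\<gamma> \<in> data2 G. gamma_rho_commute G \<gamma>} \<subseteq> data3 G"
      by (auto intro!: equivariant_hom.gamma_mult_data3 equivariant_hom.intro equivariant_hom_axioms.intro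
          abelian_group_axioms)
    show "data3 G \<subseteq> gamma_mult G ` {\<gamma> \<in> data2 G. gamma_rho_commute G \<gamma>}"
    proof
      fix m assume m: "m \<in> data3 G"
      interpret invariant_mult G m by unfold_locales (rule m)
      show "m \<in> gamma_mult G ` {\<gamma> \<in> data2 G. gamma_rho_commute G \<gamma>}"
        using mult_gamma_data2 mult_gamma_commute gamma_mult_mult_gamma
        by (intro image_eqI[where x = mult_gamma]) simp_all
    qed
  qed
qed (rule inj_on_subset[OF inj_on_gamma_mult], blast)

lemma gamma_mult_inverse_formula:
  assumes \<gamma>: "\<gamma> \<in> data2 G" and m: "m \<in> data3 G"
  shows "m = gamma_mult G \<gamma> \<longleftrightarrow> (\<forall>g\<in>carrier G. \<forall>h\<in>carrier G. \<gamma> g h = h \<oplus> m h g)"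
proof -
  interpret equivariant_hom G \<gamma> by unfold_locales (rule \<gamma>)
  show ?thesis
  proof
    assume "m = gamma_mult G \<gamma>"
    then show "\<forall>g\<in>carrier G. \<forall>h\<in>carrier G. \<gamma> g h = h \<oplus> m h g" by (simp add: gamma_mult_eq r_neg2)
  next
    interpret M: invariant_mult G m by unfold_locales (rule m)
    assume eq: "\<forall>g\<in>carrier G. \<forall>h\<in>carrier G. \<gamma> g h = h \<oplus> m h g"
    show "m = gamma_mult G \<gamma>"
      using m gamma_mult_extensional eq by (intro data3_eqI) (auto simp: data3_def gamma_mult_eq r_neg1)
  qed
qed

end


theorem theorem3p1:
  fixes G :: "('a, 'b) ring_scheme"
  assumes "abelian_group G"
  shows "bij_betw (gamma_rho G) {\<gamma> \<in> data2 G. gamma_rho_commute G \<gamma>} (data1 G)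
    \<and> bij_betw (gamma_mult G) {\<gamma> \<in> data2 G. gamma_rho_commute G \<gamma>} (data3 G)
    \<and> (\<forall>\<gamma>\<in>{\<gamma> \<in> data2 G. gamma_rho_commute G \<gamma>}. \<forall>m\<in>data3 G.
         m = gamma_mult G \<gamma> \<longleftrightarrow>
         (\<forall>g\<in>carrier G. \<forall>h\<in>carrier G. \<gamma> g h = h \<oplus>\<^bsub>G\<^esub> m h g))
    \<and> (\<forall>\<gamma>\<in>data2 G.
         let N = gamma_rho G \<gamma>; R = with_mult G (gamma_mult G \<gamma>) in
           N \<in> regular_normal G
         \<and> (\<forall>g\<in>carrier G. \<forall>h\<in>carrier G.
              g \<otimes>\<^bsub>R\<^esub> h = \<ominus>\<^bsub>G\<^esub> g \<oplus>\<^bsub>G\<^esub> \<gamma> h g \<and>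
              g \<otimes>\<^bsub>circ R\<^esub> h = \<gamma> h g \<oplus>\<^bsub>G\<^esub> h)
         \<and> (\<forall>g\<in>carrier G. nu G N g = \<gamma> g \<otimes>\<^bsub>Sym G\<^esub> rho G g)
         \<and> nu G N \<in> iso (circ R) ((Sym G) \<lparr>carrier := N\<rparr>)
         \<and> add_auto G \<subseteq> auto (circ R))"
proof -
  interpret abelian_group G by (rule assms)
  show ?thesis
  proof (intro conjI ballI)
    fix \<gamma> assume "\<gamma> \<in> data2 G"
    then interpret equivariant_hom G \<gamma> by unfold_locales
    show "let N = gamma_rho G \<gamma>; R = with_mult G (gamma_mult G \<gamma>) in
           N \<in> regular_normal G
         \<and> (\<forall>g\<in>carrier G. \<forall>h\<in>carrier G.
              g \<otimes>\<^bsub>R\<^esub> h = \<ominus>\<^bsub>G\<^esub> g \<oplus>\<^bsub>G\<^esub> \<gamma> h g \<and>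
              g \<otimes>\<^bsub>circ R\<^esub> h = \<gamma> h g \<oplus>\<^bsub>G\<^esub> h)
         \<and> (\<forall>g\<in>carrier G. nu G N g = \<gamma> g \<otimes>\<^bsub>Sym G\<^esub> rho G g)
         \<and> nu G N \<in> iso (circ R) ((Sym G) \<lparr>carrier := N\<rparr>)
         \<and> add_auto G \<subseteq> auto (circ R)"
      unfolding Let_def
      using gamma_rho_regular_normal nu_iso add_auto_circ
      by (simp add: circ_mult nu_gamma_rho) (simp add: gamma_mult_eq)
  qed (simp_all add: bij_betw_gamma_rho bij_betw_gamma_mult gamma_mult_inverse_formula)
qed

end
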